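(* Let $n\in\mathbb{Z}_{\ge 2}$ and let $\theta\in M_n(\mathbb{Q})$ be a rational skew-symmetric matrix. The algebra $C(\mathbb{S}^{2n-1}_{\theta})$ is (i) always a topologically finitely-generated module over its center $Z_{\theta}$; (ii) algebraically finitely-generated as a $Z_\theta$-module precisely when $\theta$ is integral, i.e. $\theta\in M_n(\mathbb{Z})$.
   Context: For a skew-symmetric $\theta=(\theta_{jk})\in M_n(\mathbb{R})$, $C(\mathbb{S}^{2n-1}_{\theta})$ is the universal unital $C^*$-algebra generated by normal elements $t_j$, $1\le j\le n$, subject to $t_kt_j=e^{2\pi i\theta_{jk}}t_jt_k$ and $\sum_jt_j^*t_j=1$. A $C^*$-algebra is topologically finitely generated over its center if it contains a norm-dense submodule (over the center) that is finitely generated in the algebraic sense. *)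

theory Defs
  imports
    "HOL-Analysis.Analysis"
    "HOL-Algebra.Module"
    "HOL-Algebra.Subrings"
    "HOL-Algebra.Algebraic_Closure_Type"
begin

no_notation fps_nth (infixl "$" 75)

section \<open>Unital C*-algebras\<close>

text \<open>C*-algebras are carrier-based, so that one can quantify over all C*-algebra structures on
  subsets of a given type. The inherited field \<open>smult\<close> is multiplication by complex scalars.\<close>

record 'a cstar = "(complex, 'a) module" +
  adj :: "'a \<Rightarrow> 'a"
  nrm :: "'a \<Rightarrow> real"

text \<open>The value outside the carrier is a dummy: \<^locale>\<open>Metric_space\<close> asks for symmetry and
  non-negativity everywhere.\<close>

definition nrm_dist :: "'a cstar \<Rightarrow> 'a \<Rightarrow> 'a \<Rightarrow> real" where
  "nrm_dist A x y = (if x \<in> carrier A \<and> y \<in> carrier A then nrm A (x \<ominus>\<^bsub>A\<^esub> y) else 0)"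

locale unital_cstar_algebra =
  Module.module "ring_of_type_algebra :: complex ring" A + Ring.ring A
  for A :: "'a cstar" (structure) +
  assumes smult_mult_left:
      "\<lbrakk>x \<in> carrier A; y \<in> carrier A\<rbrakk> \<Longrightarrow> (c \<odot> x) \<otimes> y = c \<odot> (x \<otimes> y)"
    and smult_mult_right:
      "\<lbrakk>x \<in> carrier A; y \<in> carrier A\<rbrakk> \<Longrightarrow> x \<otimes> (c \<odot> y) = c \<odot> (x \<otimes> y)"
    and adj_closed: "x \<in> carrier A \<Longrightarrow> adj A x \<in> carrier A"
    and adj_adj: "x \<in> carrier A \<Longrightarrow> adj A (adj A x) = x"
    and adj_add:
      "\<lbrakk>x \<in> carrier A; y \<in> carrier A\<rbrakk> \<Longrightarrow> adj A (x \<oplus> y) = adj A x \<oplus> adj A y"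
    and adj_smult: "x \<in> carrier A \<Longrightarrow> adj A (c \<odot> x) = cnj c \<odot> adj A x"
    and adj_mult:
      "\<lbrakk>x \<in> carrier A; y \<in> carrier A\<rbrakk> \<Longrightarrow> adj A (x \<otimes> y) = adj A y \<otimes> adj A x"
    and nrm_eq_0_iff: "x \<in> carrier A \<Longrightarrow> nrm A x = 0 \<longleftrightarrow> x = \<zero>"
    and nrm_triangle:
      "\<lbrakk>x \<in> carrier A; y \<in> carrier A\<rbrakk> \<Longrightarrow> nrm A (x \<oplus> y) \<le> nrm A x + nrm A y"
    and nrm_smult: "x \<in> carrier A \<Longrightarrow> nrm A (c \<odot> x) = cmod c * nrm A x"
    and nrm_mult:
      "\<lbrakk>x \<in> carrier A; y \<in> carrier A\<rbrakk> \<Longrightarrow> nrm A (x \<otimes> y) \<le> nrm A x * nrm A y"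
    and nrm_cstar: "x \<in> carrier A \<Longrightarrow> nrm A (adj A x \<otimes> x) = (nrm A x)\<^sup>2"
    and complete: "Metric_space.mcomplete (carrier A) (nrm_dist A)"
begin

lemma smult_minus_one: "x \<in> carrier A \<Longrightarrow> (-1) \<odot> x = \<ominus> x"
proof -
  assume x: "x \<in> carrier A"
  have c: "(c::complex) \<in> carrier ring_of_type_algebra" for c
    by (simp add: ring_of_type_algebra_def)
  have "(-1) \<odot> x \<oplus> 1 \<odot> x = ((-1) + 1) \<odot> x"
    using smult_l_distr[OF c c x, of "-1" 1] by (simp add: ring_of_type_algebra_def)
  moreover have "1 \<odot> x = x"
    using smult_one[OF x] by (simp add: ring_of_type_algebra_def)
  moreover have "0 \<odot> x = \<zero>"
    using smult_l_null[OF x] by (simp add: ring_of_type_algebra_def)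
  ultimately have "(-1) \<odot> x \<oplus> x = \<zero>" by simp
  then show ?thesis
    using minus_equality x smult_closed[OF c x] by metis
qed

lemma nrm_uminus: "x \<in> carrier A \<Longrightarrow> nrm A (\<ominus> x) = nrm A x"
  using nrm_smult[of x "-1"] by (simp add: smult_minus_one)

lemma nrm_nonneg: "x \<in> carrier A \<Longrightarrow> 0 \<le> nrm A x"
  using nrm_triangle[of x "\<ominus> x"] nrm_eq_0_iff[of \<zero>] by (simp add: nrm_uminus r_neg)

sublocale Metric_space "carrier A" "nrm_dist A"
proof
  fix x y z
  show "0 \<le> nrm_dist A x y"
    by (simp add: nrm_dist_def nrm_nonneg)
  show "nrm_dist A x y = nrm_dist A y x"
  proof (cases "x \<in> carrier A \<and> y \<in> carrier A")
    case True
    then have "\<ominus> (x \<ominus> y) = y \<ominus> x"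
      by (simp add: a_minus_def minus_add a_comm)
    with True nrm_uminus[of "x \<ominus> y"] show ?thesis
      by (simp add: nrm_dist_def)
  qed (auto simp: nrm_dist_def)
  assume x: "x \<in> carrier A" and y: "y \<in> carrier A"
  then show "nrm_dist A x y = 0 \<longleftrightarrow> x = y"
    by (simp add: nrm_dist_def nrm_eq_0_iff)
  assume z: "z \<in> carrier A"
  have "x \<ominus> z = (x \<ominus> y) \<oplus> (y \<ominus> z)"
    using x y z by (simp add: a_minus_def a_assoc l_neg r_neg1)
  then show "nrm_dist A x z \<le> nrm_dist A x y + nrm_dist A y z"
    using x y z nrm_triangle[of "x \<ominus> y" "y \<ominus> z"] by (simp add: nrm_dist_def)
qed

end

definition unital_star_hom :: "'a cstar \<Rightarrow> 'b cstar \<Rightarrow> ('a \<Rightarrow> 'b) set" where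
  "unital_star_hom A B = {\<phi> \<in> ring_hom A B. \<forall>x\<in>carrier A.
     (\<forall>c. \<phi> (c \<odot>\<^bsub>A\<^esub> x) = c \<odot>\<^bsub>B\<^esub> \<phi> x) \<and> \<phi> (adj A x) = adj B (\<phi> x)}"

definition cstar_subalgebra :: "'a set \<Rightarrow> 'a cstar \<Rightarrow> bool" where
  "cstar_subalgebra S A \<longleftrightarrow> subring S A \<and>
     (\<forall>x\<in>S. adj A x \<in> S \<and> (\<forall>c. c \<odot>\<^bsub>A\<^esub> x \<in> S)) \<and>
     closedin (Metric_space.mtopology (carrier A) (nrm_dist A)) S"

definition cstar_generated_by :: "'a cstar \<Rightarrow> 'a set \<Rightarrow> bool" where
  "cstar_generated_by A G \<longleftrightarrow> (\<forall>S. cstar_subalgebra S A \<and> G \<subseteq> S \<longrightarrow> S = carrier A)"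

section \<open>The algebra of a noncommutative sphere\<close>

definition sphere_relations :: "real^'n^'n \<Rightarrow> 'a cstar \<Rightarrow> ('n::finite \<Rightarrow> 'a) \<Rightarrow> bool" where
  "sphere_relations \<theta> A t \<longleftrightarrow>
     (\<forall>j. t j \<in> carrier A) \<and>
     (\<forall>j. adj A (t j) \<otimes>\<^bsub>A\<^esub> t j = t j \<otimes>\<^bsub>A\<^esub> adj A (t j)) \<and>
     (\<forall>j k. t k \<otimes>\<^bsub>A\<^esub> t j =
        exp (2 * of_real pi * \<i> * of_real (\<theta> $ j $ k)) \<odot>\<^bsub>A\<^esub> (t j \<otimes>\<^bsub>A\<^esub> t k)) \<and>
     (\<Oplus>\<^bsub>A\<^esub>j\<in>UNIV. adj A (t j) \<otimes>\<^bsub>A\<^esub> t j) = \<one>\<^bsub>A\<^esub>"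

text \<open>\<open>(A, t)\<close> is the universal unital C*-algebra generated by elements subject to the relations
  above. HOL cannot quantify over the type of the test algebra \<open>B\<close>, but no generality is lost:
  \<open>s\<close> generates a separable C*-subalgebra of \<open>B\<close>, which has at most the cardinality of the
  continuum and hence an isomorphic copy carried by a subset of \<^typ>\<open>real \<Rightarrow> complex\<close>.
  Uniqueness of \<open>\<phi>\<close> on the carrier follows from generation, as *-homomorphisms are
  contractive.\<close>

definition universal_sphere_algebra ::
    "real^'n^'n \<Rightarrow> 'a cstar \<Rightarrow> ('n::finite \<Rightarrow> 'a) \<Rightarrow> bool" where
  "universal_sphere_algebra \<theta> A t \<longleftrightarrow>
     unital_cstar_algebra A \<and> sphere_relations \<theta> A t \<and> cstar_generated_by A (range t) \<and>
     (\<forall>(B :: (real \<Rightarrow> complex) cstar) s. unital_cstar_algebra B \<and> sphere_relations \<theta> B s \<longrightarrow>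
        (\<exists>\<phi>\<in>unital_star_hom A B. \<forall>j. \<phi> (t j) = s j))"

section \<open>Finite generation over the center\<close>

definition fin_gen_module ::
    "('r, 'c) ring_scheme \<Rightarrow> ('r, 'm, 'd) module_scheme \<Rightarrow> bool" where
  "fin_gen_module R M \<longleftrightarrow> (\<exists>S. finite S \<and> S \<subseteq> carrier M \<and>
     (\<forall>x\<in>carrier M. \<exists>f\<in>S \<rightarrow> carrier R. x = (\<Oplus>\<^bsub>M\<^esub>s\<in>S. f s \<odot>\<^bsub>M\<^esub> s)))"

definition cstar_center :: "'a cstar \<Rightarrow> 'a set" where
  "cstar_center A = {z \<in> carrier A. \<forall>x\<in>carrier A. z \<otimes>\<^bsub>A\<^esub> x = x \<otimes>\<^bsub>A\<^esub> z}"

definition center_ring :: "'a cstar \<Rightarrow> 'a ring" where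
  "center_ring A =
     \<lparr>carrier = cstar_center A, monoid.mult = mult A, one = \<one>\<^bsub>A\<^esub>, zero = \<zero>\<^bsub>A\<^esub>, add = add A\<rparr>"

text \<open>\<open>A\<close> as a module over its center; note that \<open>smult\<close> is now the multiplication of \<open>A\<close>.\<close>

definition center_module :: "'a cstar \<Rightarrow> ('a, 'a) module" where
  "center_module A =
     \<lparr>carrier = carrier A, monoid.mult = mult A, one = \<one>\<^bsub>A\<^esub>, zero = \<zero>\<^bsub>A\<^esub>, add = add A,
      smult = mult A\<rparr>"

definition topologically_fin_gen_over_center :: "'a cstar \<Rightarrow> bool" where
  "topologically_fin_gen_over_center A \<longleftrightarrow>
     (\<exists>N. submodule N (center_ring A) (center_module A) \<and>
        fin_gen_module (center_ring A) (center_module A \<lparr>carrier := N\<rparr>) \<and>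
        Abstract_Topology.closure_of (Metric_space.mtopology (carrier A) (nrm_dist A)) N = carrier A)"

context unital_cstar_algebra
begin

lemma center_closed: "z \<in> cstar_center A \<Longrightarrow> z \<in> carrier A"
  by (simp add: cstar_center_def)

lemma center_comm: "\<lbrakk>z \<in> cstar_center A; x \<in> carrier A\<rbrakk> \<Longrightarrow> z \<otimes> x = x \<otimes> z"
  by (simp add: cstar_center_def)

lemma center_add: "\<lbrakk>z \<in> cstar_center A; w \<in> cstar_center A\<rbrakk> \<Longrightarrow> z \<oplus> w \<in> cstar_center A"
  by (simp add: cstar_center_def l_distr r_distr)

lemma center_uminus: "z \<in> cstar_center A \<Longrightarrow> \<ominus> z \<in> cstar_center A"
  by (simp add: cstar_center_def l_minus r_minus)

lemma center_mult:
  assumes z: "z \<in> cstar_center A" and w: "w \<in> cstar_center A"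
  shows "z \<otimes> w \<in> cstar_center A"
proof -
  have "(z \<otimes> w) \<otimes> x = x \<otimes> (z \<otimes> w)" if x: "x \<in> carrier A" for x
    using center_comm[OF z x] center_comm[OF w x] center_closed[OF z] center_closed[OF w] x m_assoc
    by metis
  then show ?thesis
    using center_closed[OF z] center_closed[OF w] by (simp add: cstar_center_def)
qed

lemma center_zero_one: "\<zero> \<in> cstar_center A" "\<one> \<in> cstar_center A"
  by (simp_all add: cstar_center_def)

lemma cring_center_ring: "cring (center_ring A)"
proof (rule cringI)
  show "abelian_group (center_ring A)"
  proof (rule abelian_groupI)
    fix z w assume "z \<in> carrier (center_ring A)" "w \<in> carrier (center_ring A)"
    then show "z \<oplus>\<^bsub>center_ring A\<^esub> w = w \<oplus>\<^bsub>center_ring A\<^esub> z"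
      using a_comm[of z w] by (simp add: center_ring_def center_closed)
  next
    fix z assume "z \<in> carrier (center_ring A)"
    then show "\<exists>y\<in>carrier (center_ring A). y \<oplus>\<^bsub>center_ring A\<^esub> z = \<zero>\<^bsub>center_ring A\<^esub>"
      by (intro bexI[of _ "\<ominus> z"]) (simp_all add: center_ring_def l_neg center_closed center_uminus)
  qed (simp_all add: center_ring_def a_assoc center_closed center_add center_zero_one)
  show "comm_monoid (center_ring A)"
  proof (rule comm_monoidI)
    fix z w assume "z \<in> carrier (center_ring A)" "w \<in> carrier (center_ring A)"
    then show "z \<otimes>\<^bsub>center_ring A\<^esub> w = w \<otimes>\<^bsub>center_ring A\<^esub> z"
      using center_comm[of z w] by (simp add: center_ring_def center_closed)
  qed (simp_all add: center_ring_def m_assoc center_closed center_mult center_zero_one)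
qed (simp add: center_ring_def l_distr center_closed)

lemma module_center_module: "Module.module (center_ring A) (center_module A)"
proof (rule moduleI[OF cring_center_ring])
  show "abelian_group (center_module A)"
  proof (rule abelian_groupI)
    fix x y assume "x \<in> carrier (center_module A)" "y \<in> carrier (center_module A)"
    then show "x \<oplus>\<^bsub>center_module A\<^esub> y = y \<oplus>\<^bsub>center_module A\<^esub> x"
      using a_comm[of x y] by (simp add: center_module_def)
  next
    fix x assume "x \<in> carrier (center_module A)"
    then show "\<exists>y\<in>carrier (center_module A). y \<oplus>\<^bsub>center_module A\<^esub> x = \<zero>\<^bsub>center_module A\<^esub>"
      by (intro bexI[of _ "\<ominus> x"]) (simp_all add: center_module_def l_neg)
  qed (simp_all add: center_module_def a_assoc)
qed (simp_all add: center_ring_def center_module_def center_closed l_distr r_distr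
    m_assoc)

end

end

theory Submission
  imports Defs
begin

text \<open>Fuglede's theorem, in the version for elements that commute up to a phase, shows that any two of
  the elements \<open>t\<^sub>j\<close> and \<open>t\<^sub>j*\<close> commute up to a \<open>q\<close>-th root of unity, where \<open>q\<close> is a common
  denominator of the entries of \<open>\<theta>\<close>. Their \<open>q\<close>-th powers are then central, and the ordered monomials
  with exponents below \<open>q\<close> span a dense submodule over the center. If \<open>\<theta>\<close> is integral, the algebra is
  commutative.

  If \<open>\<theta>\<^sub>a\<^sub>b\<close> is not an integer, then \<open>t\<^sub>a \<mapsto> sqrt (1 - r\<^sup>2) D\<close>, \<open>t\<^sub>b \<mapsto> r S\<close>, with clock and shift
  matrices \<open>D\<close> and \<open>S\<close>, and \<open>t\<^sub>l \<mapsto> 0\<close> for the remaining \<open>l\<close>, defines a representation \<open>\<phi>\<^sub>r\<close>. Central elements commute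
  with \<open>D\<close> there, and off-diagonal entries vanish in the limit \<open>r \<rightarrow> 0\<close>. So finitely many module
  generators would bound the \<open>(1, 0)\<close> entry of \<open>\<phi>\<^sub>r x\<close>, for each \<open>x\<close>, by a multiple of some \<open>g r\<close>
  with \<open>g r \<rightarrow> 0\<close>. By the Baire category theorem the bound is uniform on the unit ball; but functions
  like \<open>exp (\<i> (t\<^sub>b + t\<^sub>b*) / (8 r))\<close> have norm one and their \<open>(1, 0)\<close> entry stays away from zero.\<close>

section \<open>Calculus in unital C*-algebras\<close>

text \<open>The relations say nothing about how \<open>t\<^sub>k*\<close> moves past
  \<open>t\<^sub>j\<close>, yet words in both kinds of letters are needed for a dense span;
  Fuglede's theorem closes this gap.

  For the converse, let z be central and s a module generator. The (1, 0) entry of z s is the sum of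
  z_1k s_k0 over k, and z_10 = 0 because D has the different eigenvalues 1 and w at the positions 0
  and 1. So only off-diagonal entries of s survive. They vanish as r tends to 0, because at r = 0
  the representation has diagonal values. Any fixed element may itself be among the module
  generators, so no element chosen in advance gives a contradiction. It takes a family of bounded
  norm, one member for each r, and Baire's theorem to replace constants depending on x by a single
  one.

  Spectral theory is avoided: exponentials become powers of 1 + i u x / m, and the contractivity of
  representations becomes the weaker bound 2 ||a|| on matrix entries, obtained from a square root
  built by a fixed point argument.\<close>

context unital_cstar_algebra
begin

lemma scalar_closed [simp, intro]: "x \<in> carrier A \<Longrightarrow> c \<odot> x \<in> carrier A"
  using smult_closed by (simp add: ring_of_type_algebra_def)

lemma scalar_add: "x \<in> carrier A \<Longrightarrow> (c + d) \<odot> x = c \<odot> x \<oplus> d \<odot> x"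
  using smult_l_distr[of c d x] by (simp add: ring_of_type_algebra_def)

lemma scalar_distrib: "\<lbrakk>x \<in> carrier A; y \<in> carrier A\<rbrakk> \<Longrightarrow> c \<odot> (x \<oplus> y) = c \<odot> x \<oplus> c \<odot> y"
  using smult_r_distr[of c x y] by (simp add: ring_of_type_algebra_def)

lemma scalar_scalar [simp]: "x \<in> carrier A \<Longrightarrow> c \<odot> (d \<odot> x) = (c * d) \<odot> x"
  using smult_assoc1[of c d x] by (simp add: ring_of_type_algebra_def)

lemma scalar_one [simp]: "x \<in> carrier A \<Longrightarrow> 1 \<odot> x = x"
  using smult_one[of x] by (simp add: ring_of_type_algebra_def)

lemma scalar_zero_left [simp]: "x \<in> carrier A \<Longrightarrow> 0 \<odot> x = \<zero>"
  using smult_l_null[of x] by (simp add: ring_of_type_algebra_def)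

lemma scalar_zero_right [simp]: "c \<odot> \<zero> = \<zero>"
  using smult_r_null[of c] by (simp add: ring_of_type_algebra_def)

lemma minus_scalar: "x \<in> carrier A \<Longrightarrow> \<ominus> (c \<odot> x) = (- c) \<odot> x"
  by (simp flip: smult_minus_one)

lemma minus_eq_scalar: "\<lbrakk>x \<in> carrier A; y \<in> carrier A\<rbrakk> \<Longrightarrow> x \<ominus> y = x \<oplus> (-1) \<odot> y"
  by (simp add: a_minus_def smult_minus_one)

lemma minus_eq_zeroD: "\<lbrakk>x \<ominus> y = \<zero>; x \<in> carrier A; y \<in> carrier A\<rbrakk> \<Longrightarrow> x = y"
  using r_right_minus_eq by auto

lemma add_minus_cancel: "\<lbrakk>x \<in> carrier A; y \<in> carrier A\<rbrakk> \<Longrightarrow> (x \<oplus> y) \<ominus> y = x"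
  by (simp add: a_minus_def a_assoc r_neg)

lemma minus_cancel_left:
  "\<lbrakk>x \<in> carrier A; y \<in> carrier A; z \<in> carrier A\<rbrakk> \<Longrightarrow> (x \<oplus> y) \<ominus> (x \<oplus> z) = y \<ominus> z"
  by (metis (no_types, lifting) a_assoc a_comm a_inv_closed a_minus_def add.m_closed
      add_minus_cancel minus_add r_neg r_neg2 l_neg l_zero minus_closed)

lemma minus_add_cancel: "\<lbrakk>x \<in> carrier A; y \<in> carrier A\<rbrakk> \<Longrightarrow> (x \<ominus> y) \<oplus> y = x"
  by (simp add: a_minus_def a_assoc l_neg)

lemma add_minus_add:
  "\<lbrakk>x \<in> carrier A; y \<in> carrier A; x' \<in> carrier A; y' \<in> carrier A\<rbrakk>
    \<Longrightarrow> (x \<oplus> y) \<ominus> (x' \<oplus> y') = (x \<ominus> x') \<oplus> (y \<ominus> y')"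
  by (simp add: a_minus_def minus_add a_ac)

declare adj_closed [simp, intro] adj_adj [simp]

lemma adj_zero [simp]: "adj A \<zero> = \<zero>"
  using adj_smult[of \<zero> 0] by simp

lemma adj_one [simp]: "adj A \<one> = \<one>"
  using adj_mult[of "adj A \<one>" \<one>] by simp

lemma nrm_zero [simp]: "nrm A \<zero> = 0"
  by (simp add: nrm_eq_0_iff)

lemma nrm_one_le: "nrm A \<one> \<le> 1"
  using nrm_cstar[of \<one>] by (auto simp: power2_eq_square)

lemma nrm_adj [simp]: "x \<in> carrier A \<Longrightarrow> nrm A (adj A x) = nrm A x"
proof -
  have *: "nrm A x \<le> nrm A (adj A x)" if "x \<in> carrier A" for x
  proof -
    have "nrm A x * nrm A x \<le> nrm A (adj A x) * nrm A x"
      using nrm_cstar[of x] nrm_mult[of "adj A x" x] that by (simp add: power2_eq_square)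
    then show ?thesis
      using nrm_nonneg[OF that] nrm_nonneg[of "adj A x"] that
      by (metis adj_closed dual_order.antisym mult_right_le_imp_le linorder_not_less)
  qed
  assume "x \<in> carrier A"
  with *[of x] *[of "adj A x"] show ?thesis by simp
qed

lemma nrm_minus_commute: "\<lbrakk>x \<in> carrier A; y \<in> carrier A\<rbrakk> \<Longrightarrow> nrm A (x \<ominus> y) = nrm A (y \<ominus> x)"
  using commute[of x y] by (simp add: nrm_dist_def)

lemma nrm_minus_triangle:
  "\<lbrakk>x \<in> carrier A; y \<in> carrier A; z \<in> carrier A\<rbrakk>
    \<Longrightarrow> nrm A (x \<ominus> z) \<le> nrm A (x \<ominus> y) + nrm A (y \<ominus> z)"
  using triangle[of x y z] by (simp add: nrm_dist_def)

lemma nrm_minus_le: "\<lbrakk>x \<in> carrier A; y \<in> carrier A\<rbrakk> \<Longrightarrow> nrm A (x \<ominus> y) \<le> nrm A x + nrm A y"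
  using nrm_triangle[of x "\<ominus> y"] by (simp add: a_minus_def nrm_uminus)

lemma nrm_mult_le:
  "\<lbrakk>x \<in> carrier A; y \<in> carrier A; nrm A x \<le> a; nrm A y \<le> b\<rbrakk> \<Longrightarrow> nrm A (x \<otimes> y) \<le> a * b"
  by (meson mult_mono nrm_mult nrm_nonneg order_trans)

lemma nrm_pow_le:
  assumes "x \<in> carrier A" "nrm A x \<le> a"
  shows "nrm A (x [^] (n::nat)) \<le> a ^ n"
proof (induction n)
  case (Suc n)
  then show ?case
    using nrm_mult_le[of "x [^] n" x "a ^ n" a] assms by (simp add: mult.commute)
qed (simp add: nrm_one_le)

text \<open>The remainder consists of the binomial terms of degree at least two, and the bound is
  the same polynomial evaluated at the norm. In the induction the old remainder is multiplied by 1 +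
  x, and the new second-order term is n x^2.\<close>

lemma nrm_one_plus_pow_linear:
  assumes "x \<in> carrier A"
  shows "nrm A ((\<one> \<oplus> x) [^] (n::nat) \<ominus> (\<one> \<oplus> of_nat n \<odot> x))
    \<le> (1 + nrm A x) ^ n - 1 - n * nrm A x"
proof (induction n)
  case 0
  then show ?case using assms by (simp add: a_minus_def r_neg)
next
  case (Suc n)
  define r where "r = (\<one> \<oplus> x) [^] n \<ominus> (\<one> \<oplus> of_nat n \<odot> x)"
  have r: "r \<in> carrier A" and p: "(\<one> \<oplus> x) [^] n = r \<oplus> (\<one> \<oplus> of_nat n \<odot> x)"
    using assms by (simp_all add: r_def a_minus_def a_assoc l_neg)
  have "(\<one> \<oplus> x) [^] Suc n = (r \<oplus> (\<one> \<oplus> of_nat n \<odot> x)) \<otimes> (\<one> \<oplus> x)"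
    using p by simp
  also have "\<dots> = (r \<oplus> r \<otimes> x \<oplus> of_nat n \<odot> (x \<otimes> x)) \<oplus> (\<one> \<oplus> of_nat (Suc n) \<odot> x)"
    using assms r by (simp add: l_distr r_distr scalar_add smult_mult_left a_ac)
  finally have "(\<one> \<oplus> x) [^] Suc n \<ominus> (\<one> \<oplus> of_nat (Suc n) \<odot> x) = r \<oplus> r \<otimes> x \<oplus> of_nat n \<odot> (x \<otimes> x)"
    using assms r by (simp only: add_minus_cancel scalar_closed a_closed m_closed one_closed)
  then have "nrm A ((\<one> \<oplus> x) [^] Suc n \<ominus> (\<one> \<oplus> of_nat (Suc n) \<odot> x)) \<le> nrm A r + nrm A r * nrm A x + n * (nrm A x * nrm A x)"
    using assms r nrm_triangle[of "r \<oplus> r \<otimes> x" "of_nat n \<odot> (x \<otimes> x)"] nrm_triangle[of r "r \<otimes> x"]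
      nrm_mult[of r x] mult_left_mono[OF nrm_mult[of x x], of "real n"]
    by (simp add: nrm_smult)
  also have "nrm A r + nrm A r * nrm A x = nrm A r * (1 + nrm A x)"
    by (simp add: algebra_simps)
  also have "\<dots> \<le> ((1 + nrm A x) ^ n - 1 - n * nrm A x) * (1 + nrm A x)"
    using Suc nrm_nonneg[OF assms] unfolding r_def by (intro mult_right_mono) auto
  finally show ?case
    by (simp add: algebra_simps)
qed

lemma mult_minus_mult:
  assumes "x \<in> carrier A" "y \<in> carrier A" "x' \<in> carrier A" "y' \<in> carrier A"
  shows "(x \<otimes> y) \<ominus> (x' \<otimes> y') = (x \<ominus> x') \<otimes> y \<oplus> x' \<otimes> (y \<ominus> y')"
proof -
  define d e where "d = x \<ominus> x'" and "e = y \<ominus> y'"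
  have c: "d \<in> carrier A" "e \<in> carrier A" and xy: "x = d \<oplus> x'" "y = e \<oplus> y'"
    using assms by (auto simp: d_def e_def minus_add_cancel)
  have "x \<otimes> y = (d \<otimes> y \<oplus> x' \<otimes> e) \<oplus> x' \<otimes> y'"
    using c assms(3,4) by (simp add: xy l_distr r_distr a_ac)
  with c assms show ?thesis
    by (simp add: add_minus_cancel flip: d_def e_def)
qed

lemma in_closure_iff:
  "S \<subseteq> carrier A \<Longrightarrow> x \<in> mtopology closure_of S \<longleftrightarrow>
    x \<in> carrier A \<and> (\<forall>e>0. \<exists>y\<in>S. nrm A (x \<ominus> y) < e)"
  by (force simp: metric_closure_of nrm_dist_def)

lemma closedin_iff:
  "closedin mtopology S \<longleftrightarrow> S \<subseteq> carrier A \<and>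
    (\<forall>x\<in>carrier A. (\<forall>e>0. \<exists>y\<in>S. nrm A (x \<ominus> y) < e) \<longrightarrow> x \<in> S)"
proof (cases "S \<subseteq> carrier A")
  case True
  then have "closedin mtopology S \<longleftrightarrow> mtopology closure_of S \<subseteq> S"
    by (simp flip: closure_of_subset_eq)
  with True show ?thesis
    by (auto simp: in_closure_iff)
qed (use closedin_subset in force)

end

text \<open>The unital subalgebra generated by G, grown by one letter on the left at a time. An
  induction over it meets only a single generator in the product case; closure under general
  products is derived afterwards.\<close>

inductive_set words_span :: "'a cstar \<Rightarrow> 'a set \<Rightarrow> 'a set" for A (structure) and G where
  one: "\<one> \<in> words_span A G"
| add: "\<lbrakk>x \<in> words_span A G; y \<in> words_span A G\<rbrakk> \<Longrightarrow> x \<oplus> y \<in> words_span A G"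
| scalar: "x \<in> words_span A G \<Longrightarrow> c \<odot> x \<in> words_span A G"
| mult: "\<lbrakk>g \<in> G; x \<in> words_span A G\<rbrakk> \<Longrightarrow> g \<otimes> x \<in> words_span A G"

context unital_cstar_algebra
begin

lemma words_span_closed:
  assumes "G \<subseteq> carrier A" "x \<in> words_span A G"
  shows "x \<in> carrier A"
  using assms(2) by induction (use assms(1) in auto)

lemma words_span_mult:
  assumes G: "G \<subseteq> carrier A" and "x \<in> words_span A G" and y: "y \<in> words_span A G"
  shows "x \<otimes> y \<in> words_span A G"
  using assms(2)
proof induction
  case one
  then show ?case using y words_span_closed[OF G y] by simp
next
  case (add x x')
  then show ?case
    using words_span_closed[OF G] y by (simp add: l_distr words_span.add)
next
  case (scalar x c)
  then show ?case
    using words_span_closed[OF G] y by (simp add: smult_mult_left words_span.scalar)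
next
  case (mult g x)
  then show ?case
    using words_span_closed[OF G] y G by (simp add: m_assoc words_span.mult subset_iff)
qed

lemma words_span_adj:
  assumes G: "G \<subseteq> carrier A" "adj A ` G \<subseteq> G" and "x \<in> words_span A G"
  shows "adj A x \<in> words_span A G"
  using assms(3)
proof induction
  case one
  then show ?case by (simp add: words_span.one)
next
  case (add x x')
  then show ?case
    using words_span_closed[OF G(1)] by (simp add: adj_add words_span.add)
next
  case (scalar x c)
  then show ?case
    using words_span_closed[OF G(1)] by (simp add: adj_smult words_span.scalar)
next
  case (mult g x)
  \<comment> \<open>A single letter enters the span as the word consisting of that letter and the
    unit.\<close>
  then have "adj A g \<otimes> \<one> \<in> words_span A G"
    using G(2) by (intro words_span.intros) auto
  then have "adj A g \<in> words_span A G"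
    using mult G by auto
  then show ?case
    using words_span_closed[OF G(1)] mult G(1) words_span_mult[OF G(1)] by (auto simp: adj_mult)
qed

text \<open>The closure of the span of words is itself a C*-subalgebra, by continuity of the
  operations, and it contains the generators; minimality then makes it everything. Adjoints of
  generators have to be among the letters for the closure to be star-closed.\<close>

lemma generated_dense:
  assumes gen: "cstar_generated_by A G0" and G0: "G0 \<subseteq> G" and G: "G \<subseteq> carrier A" "adj A ` G \<subseteq> G"
  shows "mtopology closure_of (words_span A G) = carrier A"
proof -
  let ?W = "words_span A G"
  let ?C = "mtopology closure_of ?W"
  have W: "?W \<subseteq> carrier A"
    using words_span_closed[OF G(1)] by blast
  note C = in_closure_iff[OF W]
  have approx: "\<exists>y\<in>?W. nrm A (x \<ominus> y) < e" if "x \<in> ?C" "e > 0" for x e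
    using that C by blast
  have sub: "?W \<subseteq> ?C"
    using closure_of_subset W by (metis topspace_mtopology)
  have scal: "c \<odot> x \<in> ?C" if x: "x \<in> ?C" for x c
    unfolding C
  proof (intro conjI allI impI)
    fix e :: real assume "e > 0"
    then obtain y where y: "y \<in> ?W" "nrm A (x \<ominus> y) < e / (cmod c + 1)"
      using approx[OF x, of "e / (cmod c + 1)"] by (auto simp: add_nonneg_pos)
    have "c \<odot> x \<ominus> c \<odot> y = c \<odot> (x \<ominus> y)"
      using x C y W by (auto simp: minus_eq_scalar scalar_distrib)
    then have "nrm A (c \<odot> x \<ominus> c \<odot> y) = cmod c * nrm A (x \<ominus> y)"
      using x C y W by (auto simp: nrm_smult)
    also have "\<dots> \<le> (cmod c + 1) * nrm A (x \<ominus> y)"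
      using x C y W by (intro mult_right_mono nrm_nonneg) auto
    also have "\<dots> < e"
      using y(2) by (simp add: pos_less_divide_eq add_nonneg_pos mult.commute)
    finally show "\<exists>y\<in>?W. nrm A (c \<odot> x \<ominus> y) < e"
      using words_span.scalar[OF y(1)] by (rule bexI)
  qed (use x C in auto)
  have "cstar_subalgebra ?C A"
    unfolding cstar_subalgebra_def
  proof (intro conjI ballI allI)
    show "subring ?C A"
    proof (rule subringI)
      show "?C \<subseteq> carrier A" using C by blast
      show "\<one> \<in> ?C" using words_span.one sub by blast
      show "\<ominus> h \<in> ?C" if "h \<in> ?C" for h
        using scal[OF that, of "-1"] that C by (simp add: smult_minus_one)
      fix x y assume x: "x \<in> ?C" and y: "y \<in> ?C"
      then have xy: "x \<in> carrier A" "y \<in> carrier A" using C by auto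
      show "x \<oplus> y \<in> ?C"
        unfolding C
      proof (intro conjI allI impI)
        fix e :: real assume "e > 0"
        then obtain x' y' where *: "x' \<in> ?W" "nrm A (x \<ominus> x') < e/2" "y' \<in> ?W" "nrm A (y \<ominus> y') < e/2"
          using approx[OF x, of "e/2"] approx[OF y, of "e/2"] by auto
        have "(x \<oplus> y) \<ominus> (x' \<oplus> y') = (x \<ominus> x') \<oplus> (y \<ominus> y')"
          using xy * W by (intro add_minus_add) auto
        then have "nrm A ((x \<oplus> y) \<ominus> (x' \<oplus> y')) < e"
          using nrm_triangle[of "x \<ominus> x'" "y \<ominus> y'"] xy * W by (auto simp: subset_iff)
        then show "\<exists>z\<in>?W. nrm A (x \<oplus> y \<ominus> z) < e"
          using words_span.add[OF *(1,3)] by (rule bexI)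
      qed (use xy in auto)
      show "x \<otimes> y \<in> ?C"
        unfolding C
      proof (intro conjI allI impI)
        fix e :: real assume e: "e > 0"
        \<comment> \<open>M bounds the norm of y and, since d is at most 1, also that of x'. The
          error of the product is then below 2 M d, which is at most e.\<close>
        define M where "M = nrm A x + nrm A y + 1"
        have M: "M \<ge> 1" unfolding M_def using xy nrm_nonneg by (simp add: add_nonneg_nonneg)
        define d where "d = min 1 (e / (2 * M))"
        have d: "d > 0" "d \<le> 1" "d * (2 * M) \<le> e"
          using e M by (auto simp: d_def min_def field_simps)
        obtain x' y' where *: "x' \<in> ?W" "nrm A (x \<ominus> x') < d" "y' \<in> ?W" "nrm A (y \<ominus> y') < d"
          using approx[OF x d(1)] approx[OF y d(1)] by auto
        have c: "x' \<in> carrier A" "y' \<in> carrier A" using * W by auto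
        have "(x \<otimes> y) \<ominus> (x' \<otimes> y') = (x \<ominus> x') \<otimes> y \<oplus> x' \<otimes> (y \<ominus> y')"
          using xy c by (rule mult_minus_mult)
        then have "nrm A ((x \<otimes> y) \<ominus> (x' \<otimes> y')) \<le> nrm A (x \<ominus> x') * nrm A y + nrm A x' * nrm A (y \<ominus> y')"
          using nrm_triangle[of "(x \<ominus> x') \<otimes> y" "x' \<otimes> (y \<ominus> y')"] nrm_mult[of "x \<ominus> x'" y]
            nrm_mult[of x' "y \<ominus> y'"] xy c by simp
        moreover have "nrm A x' \<le> M"
          using nrm_minus_triangle[of x' x \<zero>] nrm_minus_commute[of x' x] xy c * d nrm_nonneg[of y]
          by (simp add: M_def a_minus_def)
        moreover have "nrm A y \<le> M"
          using nrm_nonneg[of x] xy by (simp add: M_def)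
        ultimately have "nrm A ((x \<otimes> y) \<ominus> (x' \<otimes> y')) \<le> nrm A (x \<ominus> x') * M + M * nrm A (y \<ominus> y')"
          using nrm_nonneg xy c
          by (smt (verit) minus_closed mult_left_mono mult_right_mono)
        also have "\<dots> < d * M + M * d"
          using * M by (intro add_strict_mono mult_strict_right_mono mult_strict_left_mono) auto
        also have "\<dots> \<le> e" using d(3) by (simp add: algebra_simps)
        finally show "\<exists>z\<in>?W. nrm A (x \<otimes> y \<ominus> z) < e"
          using words_span_mult[OF G(1) *(1,3)] by (rule bexI)
      qed (use xy in auto)
    qed
    show "c \<odot> x \<in> ?C" if "x \<in> ?C" for x c by (rule scal[OF that])
    show "adj A x \<in> ?C" if x: "x \<in> ?C" for x
      unfolding C
    proof (intro conjI allI impI)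
      fix e :: real assume "e > 0"
      then obtain y where y: "y \<in> ?W" "nrm A (x \<ominus> y) < e"
        using approx[OF x] by blast
      have "adj A x \<ominus> adj A y = adj A (x \<ominus> y)"
        using x C y W by (auto simp: minus_eq_scalar adj_add adj_smult)
      then have "nrm A (adj A x \<ominus> adj A y) < e"
        using x C y W by auto
      then show "\<exists>y\<in>?W. nrm A (adj A x \<ominus> y) < e"
        using words_span_adj[OF G y(1)] by (rule bexI)
    qed (use x C in auto)
  qed auto
  moreover have "G0 \<subseteq> ?C"
  proof
    fix g assume "g \<in> G0"
    then have "g \<otimes> \<one> \<in> ?W" "g \<in> carrier A"
      using G0 G by (auto intro!: words_span.intros)
    then show "g \<in> ?C" using sub by auto
  qed
  ultimately show ?thesis
    using gen unfolding cstar_generated_by_def by blast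
qed

lemma generated_approx:
  assumes "cstar_generated_by A G0" "G0 \<subseteq> G" "G \<subseteq> carrier A" "adj A ` G \<subseteq> G" "x \<in> carrier A" "e > 0"
  obtains y where "y \<in> words_span A G" "y \<in> carrier A" "nrm A (x \<ominus> y) < e"
  using generated_dense[OF assms(1-4)] in_closure_iff[of "words_span A G" x]
    words_span_closed[OF assms(3)] assms(5,6) by blast

text \<open>The commutator of z with x does not change when a word combination y near x is
  subtracted from x, because z commutes with y. So its norm is at most 2 ||z|| ||x - y||, which is
  arbitrarily small.\<close>

lemma central_if_commutes_generators:
  assumes gen: "cstar_generated_by A G0" "G0 \<subseteq> G" "G \<subseteq> carrier A" "adj A ` G \<subseteq> G"
    and z: "z \<in> carrier A" and comm: "\<And>g. g \<in> G \<Longrightarrow> z \<otimes> g = g \<otimes> z"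
  shows "z \<in> cstar_center A"
proof -
  have W: "z \<otimes> y = y \<otimes> z" if "y \<in> words_span A G" for y
    using that
  proof induction
    case (add x y)
    then show ?case using z words_span_closed[OF gen(3)] by (simp add: l_distr r_distr)
  next
    case (scalar x c)
    then show ?case using z words_span_closed[OF gen(3)] by (simp add: smult_mult_left smult_mult_right)
  next
    case (mult g x)
    then have "g \<in> carrier A" "x \<in> carrier A"
      using gen(3) words_span_closed[OF gen(3)] by auto
    then show ?case using z comm[OF mult(1)] mult.IH m_assoc by metis
  qed (use z in simp)
  have "z \<otimes> x = x \<otimes> z" if x: "x \<in> carrier A" for x
  proof -
    define c where "c = z \<otimes> x \<ominus> x \<otimes> z"
    have "nrm A c \<le> e" if "e > 0" for e
    proof -
      obtain y where y: "y \<in> words_span A G" "y \<in> carrier A" "nrm A (x \<ominus> y) < e / (2 * (nrm A z + 1))"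
        using generated_approx[OF gen x, of "e / (2 * (nrm A z + 1))"] \<open>e > 0\<close> nrm_nonneg[OF z] by auto
      define d where "d = x \<ominus> y"
      have d: "d \<in> carrier A" "x = y \<oplus> d"
        using x y minus_add_cancel[of x y] by (simp_all add: d_def a_comm)
      have "c = (y \<otimes> z \<oplus> z \<otimes> d) \<ominus> (y \<otimes> z \<oplus> d \<otimes> z)"
        using z y d by (simp add: c_def l_distr r_distr W)
      also have "\<dots> = z \<otimes> d \<ominus> d \<otimes> z"
        using z y d by (simp add: minus_cancel_left)
      finally have "c = z \<otimes> (x \<ominus> y) \<ominus> (x \<ominus> y) \<otimes> z"
        by (simp add: d_def)
      then have "nrm A c \<le> nrm A z * nrm A (x \<ominus> y) + nrm A (x \<ominus> y) * nrm A z"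
        using nrm_minus_le[of "z \<otimes> (x \<ominus> y)" "(x \<ominus> y) \<otimes> z"] nrm_mult[of z "x \<ominus> y"]
          nrm_mult[of "x \<ominus> y" z] x y z by (simp add: mult.commute)
      also have "\<dots> \<le> (2 * (nrm A z + 1)) * nrm A (x \<ominus> y)"
        using nrm_nonneg[of "x \<ominus> y"] x y by (simp add: algebra_simps)
      also have "\<dots> \<le> e" using y(3) nrm_nonneg[OF z] by (simp add: field_simps)
      finally show ?thesis .
    qed
    then have "nrm A c \<le> 0"
      by (meson dense_ge)
    moreover have "c \<in> carrier A" using x z by (simp add: c_def)
    ultimately have "c = \<zero>"
      using nrm_nonneg[of c] nrm_eq_0_iff[of c] by auto
    then show ?thesis using x z unfolding c_def by simp
  qed
  with z show ?thesis by (simp add: cstar_center_def)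
qed

end

section \<open>The Fuglede theorem for normal elements commuting up to a phase\<close>

lemma root_of_unity_power_self:
  "n > 0 \<Longrightarrow> exp (2 * of_real pi * \<i> / of_nat n) ^ n = (1 :: complex)"
proof -
  assume "n > 0"
  then have "of_nat n * (2 * of_real pi * \<i> / of_nat n) = (2 * of_real pi * \<i> :: complex)" by simp
  then show ?thesis
    unfolding exp_of_nat_mult[symmetric] using exp_two_pi_i by simp
qed

lemma sum_powers_root_of_unity:
  fixes N p :: nat
  assumes "0 < p" "p < N"
  defines "z \<equiv> exp (2 * of_real pi * \<i> / of_nat N) :: complex"
  shows "(\<Sum>k<N. z ^ (k * p)) = 0"
proof -
  have "z ^ p = exp (2 * of_real pi * \<i> * of_nat p / of_nat N)"
    by (simp add: z_def mult_ac flip: exp_of_nat_mult)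
  then have "z ^ p \<noteq> 1"
    using complex_root_unity_eq_1[of N p] assms by (auto dest: dvd_imp_le)
  moreover have "z ^ N = 1"
    using assms root_of_unity_power_self[of N] by (simp add: z_def)
  then have "(z ^ p) ^ N = 1"
    by (metis mult.commute power_mult power_one)
  ultimately show ?thesis
    using geometric_sum[of "z ^ p" N] by (simp add: power_mult mult.commute[of _ p])
qed

context unital_cstar_algebra
begin

primrec partial_sum :: "(nat \<Rightarrow> 'a) \<Rightarrow> nat \<Rightarrow> 'a" where
  "partial_sum f 0 = \<zero>"
| "partial_sum f (Suc n) = partial_sum f n \<oplus> f n"

lemma partial_sum_closed [simp, intro]: "(\<And>k. f k \<in> carrier A) \<Longrightarrow> partial_sum f n \<in> carrier A"
  by (induction n) auto

lemma partial_sum_scalars: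
  "x \<in> carrier A \<Longrightarrow> partial_sum (\<lambda>k. c k \<odot> x) n = (\<Sum>k<n. c k) \<odot> x"
  by (induction n) (auto simp: scalar_add)

lemma nrm_partial_sum_le:
  assumes "\<And>k. f k \<in> carrier A" "\<And>k. nrm A (f k) \<le> C"
  shows "nrm A (partial_sum f n) \<le> n * C"
proof (induction n)
  case (Suc n)
  then show ?case
    using assms(1) nrm_triangle[of "partial_sum f n" "f n"] assms(2)[of n] partial_sum_closed[of f n]
    by (simp add: algebra_simps)
qed simp

text \<open>The linear coefficient of the polynomial \<open>\<lambda> \<mapsto> (1 + (\<lambda>/m) D)\<^sup>m b\<close> is \<open>D b\<close>. Averaging over
  the \<open>(m+2)\<close>-nd roots of unity isolates it, which yields Cauchy's estimate.\<close>

lemma linear_coefficient_estimate: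
  fixes D :: "'a \<Rightarrow> 'a" and m :: nat and r K :: real
  assumes D: "\<And>x. x \<in> carrier A \<Longrightarrow> D x \<in> carrier A"
    and D_add: "\<And>x y. \<lbrakk>x \<in> carrier A; y \<in> carrier A\<rbrakk> \<Longrightarrow> D (x \<oplus> y) = D x \<oplus> D y"
    and D_scalar: "\<And>c x. x \<in> carrier A \<Longrightarrow> D (c \<odot> x) = c \<odot> D x"
    and b: "b \<in> carrier A" and m: "m > 0" and r: "r \<ge> 0"
    and bound: "\<And>l. cmod l = r \<Longrightarrow> nrm A (((\<lambda>x. x \<oplus> (l / m) \<odot> D x) ^^ m) b) \<le> K"
  shows "r * nrm A (D b) \<le> K"
proof -
  \<comment> \<open>With N = m + 2 the frequency m + 1 is -1 modulo N, hence picks out the exponent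
    1; all exponents up to m are distinct modulo N.\<close>
  define N where "N = m + 2"
  define z :: complex where "z = exp (2 * of_real pi * \<i> / of_nat N)"
  have zN: "z ^ N = 1"
    unfolding z_def by (rule root_of_unity_power_self) (simp add: N_def)
  have zc: "cmod z = 1"
    by (simp add: z_def norm_exp_eq_Re)
  define P where "P j k = ((\<lambda>x. x \<oplus> (r * z ^ k / m) \<odot> D x) ^^ j) b" for j k
  have P: "P j k \<in> carrier A" for j k
    unfolding P_def by (induction j) (auto simp: b D)
  have P_0: "P 0 k = b" and P_Suc: "P (Suc j) k = P j k \<oplus> (r * z ^ k / m) \<odot> D (P j k)" for j k
    by (simp_all add: P_def)
  \<comment> \<open>A discrete Fourier coefficient: N times the sum of the terms of degree congruent
    to -p modulo N in the polynomial after j steps, taken at radius r.\<close>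
  define E where "E p j = partial_sum (\<lambda>k. z ^ (k * p) \<odot> P j k) N" for p j
  have E: "E p j \<in> carrier A" for p j
    unfolding E_def using P by auto
  have D0: "D \<zero> = \<zero>"
    using D_scalar[of \<zero> 0] D[of \<zero>] by simp
  \<comment> \<open>A step multiplies by r z^k, which shifts the frequency p by one.\<close>
  have E_Suc: "E p (Suc j) = E p j \<oplus> (r / m) \<odot> D (E (Suc p) j)" for p j
  proof -
    have "partial_sum (\<lambda>k. z ^ (k * p) \<odot> P (Suc j) k) n =
      partial_sum (\<lambda>k. z ^ (k * p) \<odot> P j k) n \<oplus>
      (r / m) \<odot> D (partial_sum (\<lambda>k. z ^ (k * Suc p) \<odot> P j k) n)" for n
    proof (induction n)
      case (Suc n)
      show ?case
      proof -
        have step: "z ^ (n * p) \<odot> P (Suc j) n =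
            z ^ (n * p) \<odot> P j n \<oplus> (r / m) \<odot> D (z ^ (n * Suc p) \<odot> P j n)"
          using P D by (simp add: P_Suc scalar_distrib D_scalar power_add mult_ac)
        show ?thesis
          unfolding partial_sum.simps Suc step using P D by (simp add: scalar_distrib D_add a_ac)
      qed
    qed (simp add: D0)
    then show ?thesis unfolding E_def .
  qed
  have E_0: "E p 0 = (\<Sum>k<N. z ^ (k * p)) \<odot> b" for p
    unfolding E_def P_0 using partial_sum_scalars b by simp
  \<comment> \<open>The degrees run from 0 to j, so after the shift by p they stay strictly between
    0 and N and average to zero.\<close>
  have vanish: "E p j = \<zero>" if "0 < p" "p + j < N" for p j
    using that
  proof (induction j arbitrary: p)
    case 0
    then show ?case
      using sum_powers_root_of_unity[of p N] b by (simp add: E_0 z_def)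
  next
    case (Suc j)
    then show ?case by (simp add: E_Suc D0)
  qed
  have const: "E 0 j = of_nat N \<odot> b" if "j < N" for j
    using that
  proof (induction j)
    case (Suc j)
    then show ?case using vanish[of 1 j] b by (simp add: E_Suc D0)
  qed (simp add: E_0)
  have periodic: "E N j = E 0 j" for j
    unfolding E_def by (simp add: mult.commute[of _ N] power_mult zN)
  \<comment> \<open>Frequency m + 1 is fed by frequency m + 2 = N, which is frequency 0 again and
    carries the constant term N b. Each of the j steps therefore contributes N (r/m) D b.\<close>
  have lin: "E (Suc m) j = (of_nat N * r * of_nat j / m) \<odot> D b" if "j \<le> m" for j
    using that
  proof (induction j)
    case 0
    then show ?case using b D vanish[of "Suc m" 0] by (simp add: N_def)
  next
    case (Suc j)
    have "E (Suc (Suc m)) j = of_nat N \<odot> b"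
      using periodic[of j] const[of j] Suc.prems by (simp add: N_def)
    then have "E (Suc m) (Suc j) = (of_nat N * r * of_nat j / m) \<odot> D b \<oplus> (r / m) \<odot> D (of_nat N \<odot> b)"
      using Suc by (simp add: E_Suc)
    also have "\<dots> = (of_nat N * r * of_nat j / m + r / m * of_nat N) \<odot> D b"
      using b D by (simp add: D_scalar scalar_add)
    also have "of_nat N * r * of_nat j / m + r / m * of_nat N = (of_nat N * r * of_nat (Suc j) / m :: complex)"
      using m by (simp add: field_simps)
    finally show ?case .
  qed
  have "nrm A (E (Suc m) m) \<le> N * K"
    unfolding E_def
  proof (rule nrm_partial_sum_le)
    show "nrm A (z ^ (k * Suc m) \<odot> P m k) \<le> K" for k
      using bound[of "r * z ^ k"] P r by (simp add: nrm_smult norm_mult norm_power zc flip: P_def)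
  qed (use P in auto)
  also have "E (Suc m) m = (of_nat N * r) \<odot> D b"
    using lin[of m] m by simp
  also have "nrm A \<dots> = N * (r * nrm A (D b))"
    using b D r by (simp add: nrm_smult norm_mult)
  finally show ?thesis
    by (simp add: N_def)
qed

text \<open>The first-order terms cancel in the product of 1 - k and 1 + k, which leaves 1 - k^2,
  and the C*-identity applies. A product of m such factors with c of order 1/m thus stays
  bounded.\<close>

lemma nrm_one_plus_skew:
  assumes k: "k \<in> carrier A" "adj A k = \<ominus> k" and c: "nrm A k \<le> c"
  shows "(nrm A (\<one> \<oplus> k))\<^sup>2 \<le> 1 + c\<^sup>2"
proof -
  have "adj A (\<one> \<oplus> k) \<otimes> (\<one> \<oplus> k) = \<one> \<ominus> k \<otimes> k"
    using k by (simp add: adj_add l_distr r_distr a_minus_def l_minus r_minus a_assoc r_neg1)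
  then have "(nrm A (\<one> \<oplus> k))\<^sup>2 \<le> nrm A \<one> + nrm A (k \<otimes> k)"
    using nrm_cstar[of "\<one> \<oplus> k"] nrm_minus_le[of \<one> "k \<otimes> k"] k by simp
  also have "\<dots> \<le> 1 + c\<^sup>2"
    using nrm_one_le nrm_mult_le[OF k(1) k(1) c c] by (simp add: power2_eq_square)
  finally show ?thesis .
qed

text \<open>Rosenblum's argument. If \<open>D x = a* x - w' x a*\<close> with \<open>w' = cnj w\<close> and \<open>D' x = a x - w x a\<close>,
  then \<open>D'\<close> annihilates the orbit of \<open>b\<close> under \<open>D\<close>, so \<open>1 + l D\<close> acts on it like
  \<open>1 + l D - cnj l D'\<close>. The latter is \<open>x \<mapsto> x + k x - x k'\<close> for skew-adjoint \<open>k\<close> and \<open>k'\<close>, which is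
  isometric up to second order.\<close>

theorem Fuglede_phase:
  assumes a: "a \<in> carrier A" and b: "b \<in> carrier A"
    and normal: "adj A a \<otimes> a = a \<otimes> adj A a"
    and w: "cmod w = 1" and comm: "a \<otimes> b = w \<odot> (b \<otimes> a)"
  shows "adj A a \<otimes> b = cnj w \<odot> (b \<otimes> adj A a)"
proof -
  define s where "s = adj A a"
  have s: "s \<in> carrier A" and sa: "s \<otimes> a = a \<otimes> s"
    using a normal by (auto simp: s_def)
  define D where "D x = s \<otimes> x \<ominus> cnj w \<odot> (x \<otimes> s)" for x
  have D: "D x \<in> carrier A" if "x \<in> carrier A" for x
    using that s by (simp add: D_def)
  have ww: "w * cnj w = 1" "cnj w * w = 1"
    using w complex_norm_square[of w] by (simp_all add: mult.commute)
  have D_comm: "a \<otimes> D x = w \<odot> (D x \<otimes> a)" if x: "x \<in> carrier A" and ax: "a \<otimes> x = w \<odot> (x \<otimes> a)" for x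
  proof -
    have "a \<otimes> (s \<otimes> x) = s \<otimes> (a \<otimes> x)"
      using a s sa x by (simp flip: m_assoc)
    also have "\<dots> = w \<odot> (s \<otimes> x \<otimes> a)"
      using a s x by (simp add: ax smult_mult_right m_assoc)
    finally have 1: "a \<otimes> (s \<otimes> x) = w \<odot> (s \<otimes> x \<otimes> a)" .
    have "a \<otimes> (x \<otimes> s) = w \<odot> (x \<otimes> a) \<otimes> s"
      using a s x by (simp flip: m_assoc add: ax)
    also have "\<dots> = w \<odot> (x \<otimes> s \<otimes> a)"
      using a s x by (simp add: smult_mult_left m_assoc sa)
    finally have 2: "a \<otimes> (x \<otimes> s) = w \<odot> (x \<otimes> s \<otimes> a)" .
    show ?thesis
      unfolding D_def using a s x
      by (simp add: minus_eq_scalar r_distr l_distr smult_mult_left smult_mult_right 1 2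
          scalar_distrib mult_ac)
  qed
  define C where "C = nrm A a"
  have C: "C \<ge> 0" using a by (simp add: C_def nrm_nonneg)
  have estimate: "r * nrm A (D b) \<le> exp 1 * nrm A b" if r: "r > 0" for r
  proof -
    \<comment> \<open>With c = 2 r C / m, the m-fold product of 1 + 2 c^2 is at most exp (8 r^2 C^2
      / m), hence at most exp 1 for this m.\<close>
    obtain m :: nat where m: "m > 8 * r\<^sup>2 * C\<^sup>2"
      using reals_Archimedean2 by blast
    then have m0: "m > 0"
      by (metis C mult_nonneg_nonneg not_gr0 of_nat_0 order.asym zero_le_power2 zero_le_numeral order_le_less linorder_not_le)
    define c where "c = 2 * r * C / m"
    have c: "c \<ge> 0" using C r by (simp add: c_def)
    have step: "nrm A (x \<oplus> (l / m) \<odot> D x) \<le> (1 + 2 * c\<^sup>2) * nrm A x"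
      if x: "x \<in> carrier A" and ax: "a \<otimes> x = w \<odot> (x \<otimes> a)" and l: "cmod l = r" for x l
    proof -
      define u where "u = l / m"
      have u: "2 * (cmod u * C) = c" using l by (simp add: u_def c_def norm_divide)
      define k where "k = u \<odot> s \<ominus> cnj u \<odot> a"
      define k' where "k' = (u * cnj w) \<odot> s \<ominus> cnj (u * cnj w) \<odot> a"
      have kk: "k \<in> carrier A" "k' \<in> carrier A" using a s by (auto simp: k_def k'_def)
      have skew: "adj A k = \<ominus> k" "adj A k' = \<ominus> k'"
        unfolding k_def k'_def using a s
        by (simp_all add: minus_eq_scalar adj_add adj_smult s_def minus_add minus_scalar a_comm)
      have nk: "nrm A k \<le> c" "nrm A k' \<le> c"
        using nrm_minus_le[of "u \<odot> s" "cnj u \<odot> a"] a s u w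
          nrm_minus_le[of "(u * cnj w) \<odot> s" "cnj (u * cnj w) \<odot> a"]
        by (simp_all add: k_def k'_def nrm_smult norm_mult s_def mult.commute flip: C_def)
      have "x \<oplus> (l / m) \<odot> D x = x \<oplus> (k \<otimes> x \<ominus> x \<otimes> k')"
      proof -
        have "k \<otimes> x = u \<odot> (s \<otimes> x) \<ominus> (cnj u * w) \<odot> (x \<otimes> a)"
          using a s x by (simp add: k_def minus_eq_scalar l_distr smult_mult_left ax)
        moreover have "x \<otimes> k' = (u * cnj w) \<odot> (x \<otimes> s) \<ominus> (cnj u * w) \<odot> (x \<otimes> a)"
          using a s x by (simp add: k'_def minus_eq_scalar r_distr smult_mult_right)
        moreover have "(p \<ominus> q) \<ominus> (p' \<ominus> q) = p \<ominus> p'"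
          if "p \<in> carrier A" "q \<in> carrier A" "p' \<in> carrier A" for p p' q
          using minus_cancel_left[of "\<ominus> q" p p'] that by (simp add: a_minus_def a_comm)
        ultimately have "k \<otimes> x \<ominus> x \<otimes> k' = u \<odot> (s \<otimes> x) \<ominus> (u * cnj w) \<odot> (x \<otimes> s)"
          using a s x by simp
        also have "\<dots> = u \<odot> D x"
          using a s x by (simp add: D_def minus_eq_scalar scalar_distrib)
        finally show ?thesis by (simp add: u_def)
      qed
      \<comment> \<open>Writing the first-order expression as a two-sided product costs only the
        term k x k', which is of second order in c.\<close>
      also have "\<dots> = (\<one> \<oplus> k) \<otimes> x \<otimes> (\<one> \<oplus> \<ominus> k') \<oplus> k \<otimes> x \<otimes> k'"
      proof -
        have "(\<one> \<oplus> k) \<otimes> x \<otimes> (\<one> \<oplus> \<ominus> k') = (x \<oplus> (k \<otimes> x \<ominus> x \<otimes> k')) \<ominus> k \<otimes> x \<otimes> k'"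
          using kk x by (simp add: l_distr r_distr minus_eq_scalar scalar_distrib smult_mult_right
              m_assoc a_ac flip: smult_minus_one)
        then show ?thesis using kk x by (simp add: minus_add_cancel)
      qed
      also have "nrm A \<dots> \<le> nrm A (\<one> \<oplus> k) * nrm A x * nrm A (\<one> \<oplus> \<ominus> k') + c * nrm A x * c"
      proof (intro order.trans[OF nrm_triangle] add_mono)
        show "nrm A ((\<one> \<oplus> k) \<otimes> x \<otimes> (\<one> \<oplus> \<ominus> k')) \<le> nrm A (\<one> \<oplus> k) * nrm A x * nrm A (\<one> \<oplus> \<ominus> k')"
          using kk x by (intro nrm_mult_le nrm_mult) auto
        show "nrm A (k \<otimes> x \<otimes> k') \<le> c * nrm A x * c"
          using kk x nk by (intro nrm_mult_le) auto
      qed (use kk x in auto)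
      also have "\<dots> = (nrm A (\<one> \<oplus> k) * nrm A (\<one> \<oplus> \<ominus> k') + c\<^sup>2) * nrm A x"
        by (simp add: algebra_simps power2_eq_square)
      also have "\<dots> \<le> ((1 + c\<^sup>2) + c\<^sup>2) * nrm A x"
      proof (intro mult_right_mono add_right_mono nrm_nonneg x)
        have "(nrm A (\<one> \<oplus> k))\<^sup>2 \<le> 1 + c\<^sup>2" "(nrm A (\<one> \<oplus> \<ominus> k'))\<^sup>2 \<le> 1 + c\<^sup>2"
          using nrm_one_plus_skew[of k c] nrm_one_plus_skew[of "\<ominus> k'" c] kk skew nk nrm_uminus[of k']
            adj_smult[of k' "-1"] by (simp_all add: smult_minus_one minus_minus)
        then show "nrm A (\<one> \<oplus> k) * nrm A (\<one> \<oplus> \<ominus> k') \<le> 1 + c\<^sup>2"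
          using sum_squares_bound[of "nrm A (\<one> \<oplus> k)" "nrm A (\<one> \<oplus> \<ominus> k')"] by linarith
      qed
      finally show ?thesis by (simp add: add.commute)
    qed
    show ?thesis
    proof (rule linear_coefficient_estimate[where m = m, of D])
      fix l assume l: "cmod l = r"
      define T where "T = (\<lambda>x. x \<oplus> (l / m) \<odot> D x)"
      have "(T ^^ j) b \<in> carrier A \<and> a \<otimes> (T ^^ j) b = w \<odot> ((T ^^ j) b \<otimes> a) \<and>
          nrm A ((T ^^ j) b) \<le> (1 + 2 * c\<^sup>2) ^ j * nrm A b" for j
      proof (induction j)
        case (Suc j)
        define x where "x = (T ^^ j) b"
        have x: "x \<in> carrier A" "a \<otimes> x = w \<odot> (x \<otimes> a)" "nrm A x \<le> (1 + 2 * c\<^sup>2) ^ j * nrm A b"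
          using Suc by (simp_all add: x_def)
        have "nrm A (T x) \<le> (1 + 2 * c\<^sup>2) * ((1 + 2 * c\<^sup>2) ^ j * nrm A b)"
          using step[OF x(1,2) l] mult_left_mono[OF x(3), of "1 + 2 * c\<^sup>2"] by (simp add: T_def)
        moreover have "a \<otimes> T x = w \<odot> (T x \<otimes> a)"
          using a x D[OF x(1)] D_comm[OF x(1,2)]
          by (simp add: T_def l_distr r_distr smult_mult_left smult_mult_right scalar_distrib mult_ac)
        moreover have "T x \<in> carrier A" using x D by (simp add: T_def)
        ultimately show ?case by (simp add: x_def mult.assoc)
      qed (use a b comm in auto)
      then have "nrm A ((T ^^ m) b) \<le> (1 + 2 * c\<^sup>2) ^ m * nrm A b" by blast
      also have "\<dots> \<le> exp 1 * nrm A b"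
      proof (intro mult_right_mono nrm_nonneg b)
        have "(1 + 2 * c\<^sup>2) ^ m \<le> exp (2 * c\<^sup>2) ^ m"
          by (intro power_mono) (auto simp: add.commute)
        also have "\<dots> = exp (8 * r\<^sup>2 * C\<^sup>2 / m)"
          using m0 by (simp add: c_def power2_eq_square field_simps flip: exp_of_nat_mult)
        also have "\<dots> \<le> exp 1"
          using m m0 by (simp add: field_simps)
        finally show "(1 + 2 * c\<^sup>2) ^ m \<le> exp 1" .
      qed
      finally show "nrm A (((\<lambda>x. x \<oplus> (l / m) \<odot> D x) ^^ m) b) \<le> exp 1 * nrm A b"
        by (simp add: T_def)
    next
      show "D (x \<oplus> y) = D x \<oplus> D y" if "x \<in> carrier A" "y \<in> carrier A" for x y
        using that s by (simp add: D_def minus_eq_scalar l_distr r_distr scalar_distrib a_ac)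
      show "D (d \<odot> x) = d \<odot> D x" if "x \<in> carrier A" for d x
        using that s by (simp add: D_def minus_eq_scalar smult_mult_left smult_mult_right scalar_distrib mult_ac)
    qed (use D b m0 r in auto)
  qed
  \<comment> \<open>Liouville's argument: the bound on r ||D b|| does not depend on r. The summand 1
    in B makes the radius B / e positive.\<close>
  have "nrm A (D b) \<le> e" if "e > 0" for e
  proof -
    define B where "B = exp 1 * nrm A b + 1"
    have B: "B > 0" using nrm_nonneg[OF b] by (simp add: B_def add_nonneg_pos)
    then have "B / e * nrm A (D b) \<le> B"
      using estimate[of "B / e"] that by (simp add: B_def)
    then show ?thesis using B that by (simp add: field_simps)
  qed
  then have "nrm A (D b) \<le> 0" by (meson dense_ge)
  then have "D b = \<zero>"
    using nrm_nonneg[of "D b"] nrm_eq_0_iff[of "D b"] D[OF b] by auto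
  then show ?thesis
    using minus_eq_zeroD s b by (simp add: D_def s_def)
qed

end

section \<open>Topological finite generation\<close>

text \<open>The algebra, its center module and the submodules of the latter share their addition but
  not their records, and \<open>finsum\<close> depends on the carrier. This transfers sums between
  them.\<close>

lemma finsum_eq_if_same_addition:
  assumes "abelian_monoid G" "abelian_monoid H"
    and "add G = add H" "zero G = zero H"
    and "f \<in> S \<rightarrow> carrier G" "f \<in> S \<rightarrow> carrier H"
  shows "finsum G f S = finsum H f S"
proof -
  interpret G: abelian_monoid G by fact
  interpret H: abelian_monoid H by fact
  show ?thesis
    using assms(5,6)
  proof (induction S rule: infinite_finite_induct)
    case (insert s S)
    then show ?case using assms(3,4) by (simp add: G.finsum_insert H.finsum_insert Pi_iff)
  qed (auto simp: G.finsum_infinite H.finsum_infinite assms(4))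
qed

section \<open>Submodules generated over the center\<close>

context unital_cstar_algebra
begin

definition center_span :: "'a set \<Rightarrow> 'a set" where
  "center_span S = (\<lambda>f. \<Oplus>s\<in>S. f s \<otimes> s) ` (S \<rightarrow> cstar_center A)"

lemma center_span_memI: "f \<in> S \<rightarrow> cstar_center A \<Longrightarrow> (\<Oplus>s\<in>S. f s \<otimes> s) \<in> center_span S"
  by (simp add: center_span_def)

lemma coeff_closed:
  "\<lbrakk>S \<subseteq> carrier A; f \<in> S \<rightarrow> cstar_center A\<rbrakk> \<Longrightarrow> (\<lambda>s. f s \<otimes> s) \<in> S \<rightarrow> carrier A"
  by (auto simp: Pi_iff center_closed)

lemma center_span_closed: "S \<subseteq> carrier A \<Longrightarrow> center_span S \<subseteq> carrier A"
  using coeff_closed by (auto simp: center_span_def intro!: finsum_closed)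

lemma center_span_add:
  assumes S: "S \<subseteq> carrier A" and "x \<in> center_span S" "y \<in> center_span S"
  shows "x \<oplus> y \<in> center_span S"
proof -
  from assms obtain f g where f: "f \<in> S \<rightarrow> cstar_center A" "x = (\<Oplus>s\<in>S. f s \<otimes> s)"
    and g: "g \<in> S \<rightarrow> cstar_center A" "y = (\<Oplus>s\<in>S. g s \<otimes> s)"
    by (auto simp: center_span_def)
  have "(\<Oplus>s\<in>S. (f s \<oplus> g s) \<otimes> s) = (\<Oplus>s\<in>S. f s \<otimes> s \<oplus> g s \<otimes> s)"
    using f g S by (intro finsum_cong') (auto simp: Pi_iff center_closed l_distr subset_iff)
  also have "\<dots> = x \<oplus> y"
    using f g coeff_closed[OF S] by (simp add: finsum_addf)
  finally show ?thesis
    using f g center_span_memI[of "\<lambda>s. f s \<oplus> g s" S] by (auto simp: Pi_iff center_add)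
qed

lemma center_span_mult:
  assumes S: "finite S" "S \<subseteq> carrier A" and z: "z \<in> cstar_center A" and "x \<in> center_span S"
  shows "z \<otimes> x \<in> center_span S"
proof -
  from assms obtain f where f: "f \<in> S \<rightarrow> cstar_center A" "x = (\<Oplus>s\<in>S. f s \<otimes> s)"
    by (auto simp: center_span_def)
  have "z \<otimes> x = (\<Oplus>s\<in>S. z \<otimes> (f s \<otimes> s))"
    using f coeff_closed[OF S(2)] S z by (simp add: finsum_rdistr center_closed)
  also have "\<dots> = (\<Oplus>s\<in>S. (z \<otimes> f s) \<otimes> s)"
    using f S z by (intro finsum_cong') (auto simp: Pi_iff center_closed m_assoc subset_iff)
  finally show ?thesis
    using f z center_span_memI[of "\<lambda>s. z \<otimes> f s" S] by (auto simp: Pi_iff center_mult)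
qed

lemma center_span_superset:
  assumes S: "finite S" "S \<subseteq> carrier A" and s: "s \<in> S"
  shows "s \<in> center_span S"
proof -
  have "(\<Oplus>r\<in>S. (if s = r then \<one> else \<zero>) \<otimes> r) = (\<Oplus>r\<in>S. if s = r then r else \<zero>)"
    using S by (intro finsum_cong') auto
  also have "\<dots> = s"
    using finsum_singleton[OF s S(1), of "\<lambda>r. r"] S by auto
  finally show ?thesis
    using center_span_memI[of "\<lambda>r. if s = r then \<one> else \<zero>" S] by (auto simp: center_zero_one)
qed

lemma center_span_zero: "S \<subseteq> carrier A \<Longrightarrow> \<zero> \<in> center_span S"
proof -
  assume S: "S \<subseteq> carrier A"
  have "(\<Oplus>s\<in>S. \<zero> \<otimes> s) = (\<Oplus>s\<in>S. \<zero>)"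
    using S by (intro finsum_cong') auto
  then show ?thesis
    using center_span_memI[of "\<lambda>s. \<zero>" S] by (auto simp: center_zero_one finsum_zero)
qed

lemma center_span_induct [consumes 3, case_names zero add generator]:
  assumes S: "finite S" "S \<subseteq> carrier A" and x: "x \<in> center_span S"
    and zero: "P \<zero>" and add: "\<And>x y. \<lbrakk>x \<in> carrier A; y \<in> carrier A; P x; P y\<rbrakk> \<Longrightarrow> P (x \<oplus> y)"
    and gen: "\<And>z s. \<lbrakk>z \<in> cstar_center A; s \<in> S\<rbrakk> \<Longrightarrow> P (z \<otimes> s)"
  shows "P x"
proof -
  obtain f where f: "f \<in> S \<rightarrow> cstar_center A" and x: "x = (\<Oplus>s\<in>S. f s \<otimes> s)"
    using x by (auto simp: center_span_def)
  have "P (\<Oplus>s\<in>T. f s \<otimes> s)" if "T \<subseteq> S" for T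
    using finite_subset[OF that S(1)] that
  proof (induction T rule: finite_induct)
    case (insert s T)
    moreover from insert have "(\<lambda>s. f s \<otimes> s) \<in> T \<rightarrow> carrier A" "f s \<otimes> s \<in> carrier A"
      using coeff_closed[OF S(2) f] by auto
    ultimately show ?case
      using f by (auto simp: finsum_insert intro!: add gen finsum_closed)
  qed (simp add: zero)
  then show ?thesis by (simp add: x)
qed

lemma scalar_mult_one_center: "c \<odot> \<one> \<in> cstar_center A"
  by (simp add: cstar_center_def smult_mult_left smult_mult_right)

text \<open>Complex scalars act through the central elements c 1, so a submodule over the center is
  also a complex subspace.\<close>

lemma center_span_scalar:
  assumes S: "finite S" "S \<subseteq> carrier A" and "x \<in> center_span S"
  shows "c \<odot> x \<in> center_span S"
proof -
  have "c \<odot> x = (c \<odot> \<one>) \<otimes> x"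
    using assms center_span_closed by (simp add: smult_mult_left subset_iff)
  then show ?thesis
    using assms by (simp add: center_span_mult scalar_mult_one_center)
qed

text \<open>Left multiplication by a passes through central coefficients, so it is linear over the
  center and needs to be checked on generators only.\<close>

lemma center_span_left_mult:
  assumes S: "finite S" "S \<subseteq> carrier A" and T: "finite T" "T \<subseteq> carrier A" and a: "a \<in> carrier A"
    and gen: "\<And>s. s \<in> S \<Longrightarrow> a \<otimes> s \<in> center_span T" and x: "x \<in> center_span S"
  shows "a \<otimes> x \<in> center_span T"
  using S x
proof (induction rule: center_span_induct)
  case zero
  then show ?case using a T by (simp add: center_span_zero)
next
  case (add x y)
  then show ?case using a T by (simp add: r_distr center_span_add)
next
  case (generator z s)
  have "a \<otimes> (z \<otimes> s) = z \<otimes> (a \<otimes> s)"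
    using generator S a center_closed[of z] center_comm[of z a]  by (auto simp flip: m_assoc)
  then show ?case using T generator gen by (simp add: center_span_mult)
qed

section \<open>Ordered monomials with bounded exponents\<close>

fun monomials :: "nat \<Rightarrow> 'a list \<Rightarrow> 'a set" where
  "monomials q [] = {\<one>}"
| "monomials q (g # gs) = (\<lambda>(k, w). g [^] k \<otimes> w) ` ({..<q} \<times> monomials q gs)"

lemma finite_monomials: "finite (monomials q gs)"
  by (induction gs) auto

lemma monomials_closed: "set gs \<subseteq> carrier A \<Longrightarrow> monomials q gs \<subseteq> carrier A"
  by (induction gs) auto

lemma one_in_monomials: "q > 0 \<Longrightarrow> \<one> \<in> monomials q gs"
  by (induction gs) (auto intro!: image_eqI[of _ _ "(0, \<one>)"])

text \<open>For c a q-th root of unity and k = q the phase disappears; this is what makes q-th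
  powers of the generators central.\<close>

lemma phase_commute_pow:
  assumes "g \<in> carrier A" "h \<in> carrier A" "h \<otimes> g = c \<odot> (g \<otimes> h)"
  shows "h \<otimes> g [^] (k::nat) = (c ^ k) \<odot> (g [^] k \<otimes> h)"
proof (induction k)
  case (Suc k)
  have "h \<otimes> g [^] Suc k = (h \<otimes> g [^] k) \<otimes> g"
    using assms by (simp add: m_assoc)
  also have "\<dots> = (c ^ k) \<odot> (g [^] k \<otimes> (h \<otimes> g))"
    using assms(1,2) Suc by (simp add: smult_mult_left m_assoc)
  also have "\<dots> = (c ^ Suc k) \<odot> (g [^] Suc k \<otimes> h)"
    using assms by (simp add: smult_mult_right m_assoc mult.commute)
  finally show ?case .
qed (use assms in simp)

text \<open>The letter h moves past the powers of the letters listed before it at the cost of a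
  scalar. At its own place it raises the exponent by one, and an exponent reaching q is absorbed
  into the central coefficient.\<close>

lemma monomials_left_mult:
  assumes gs: "set gs \<subseteq> carrier A" and q: "q > 0"
    and phase: "\<And>g h. \<lbrakk>g \<in> set gs; h \<in> set gs\<rbrakk> \<Longrightarrow> \<exists>c. h \<otimes> g = c \<odot> (g \<otimes> h)"
    and central: "\<And>g. g \<in> set gs \<Longrightarrow> g [^] q \<in> cstar_center A"
    and "h \<in> set gs" "w \<in> monomials q gs"
  shows "h \<otimes> w \<in> center_span (monomials q gs)"
  using assms
proof (induction gs arbitrary: h w)
  case (Cons g gs)
  let ?W = "monomials q gs" and ?W' = "monomials q (g # gs)"
  have g: "g \<in> carrier A" and gs: "set gs \<subseteq> carrier A" and h: "h \<in> carrier A"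
    using Cons.prems by auto
  note fin = finite_monomials monomials_closed[OF gs] finite_monomials
    monomials_closed[OF Cons.prems(1)]
  from Cons.prems(6) obtain k v where k: "k < q" and v: "v \<in> ?W" and w: "w = g [^] k \<otimes> v"
    by auto
  have vc: "v \<in> carrier A" using v monomials_closed[OF gs] by auto
  have in_W': "g [^] j \<otimes> u \<in> center_span ?W'" if "j < q" "u \<in> ?W" for j u
    using that fin by (intro center_span_superset) auto
  show ?case
  proof (cases "h = g")
    case True
    have gw: "h \<otimes> w = g [^] Suc k \<otimes> v"
      using g vc True by (simp only: w nat_pow_Suc2) (simp add: m_assoc)
    show ?thesis
    proof (cases "Suc k < q")
      case False
      \<comment> \<open>The exponent wraps around: g^q becomes the coefficient of the monomial with
        exponent 0 at g.\<close>
      then have "Suc k = q" using k by simp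
      moreover have "g [^] (0::nat) \<otimes> v \<in> center_span ?W'"
        using q v by (intro in_W') auto
      ultimately show ?thesis
        using Cons.prems(4)[of g] fin vc by (simp add: gw center_span_mult del: monomials.simps nat_pow_Suc)
    next
      case True
      then show ?thesis unfolding gw using v by (rule in_W')
    qed
  next
    case False
    then have "h \<in> set gs" using Cons.prems by simp
    moreover obtain c where "h \<otimes> g = c \<odot> (g \<otimes> h)"
      using Cons.prems(3)[of g h] Cons.prems(5) by auto
    note phase_commute_pow[OF g h this, of k]
    then have "h \<otimes> w = (c ^ k) \<odot> (g [^] k \<otimes> (h \<otimes> v))"
      using g h vc by (simp add: w smult_mult_left flip: m_assoc)
    moreover have hv: "h \<otimes> v \<in> center_span ?W"
      using Cons.prems Cons.IH[OF gs q] v \<open>h \<in> set gs\<close> by auto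
    have "g [^] k \<otimes> (h \<otimes> v) \<in> center_span ?W'"
      by (rule center_span_left_mult[OF fin nat_pow_closed[OF g] in_W'[OF k] hv])
    ultimately show ?thesis
      using center_span_scalar[OF fin(3,4)] by simp
  qed
qed simp

lemma fin_gen_center_span:
  assumes S: "finite S" "S \<subseteq> carrier A"
  shows "submodule (center_span S) (center_ring A) (center_module A)"
    and "fin_gen_module (center_ring A) (center_module A \<lparr>carrier := center_span S\<rparr>)"
proof -
  let ?N = "center_span S"
  interpret M: module "center_ring A" "center_module A" by (rule module_center_module)
  have inv: "a_inv (center_module A) = a_inv A"
    by (simp add: a_inv_def m_inv_def center_module_def fun_eq_iff)
  show sub: "submodule ?N (center_ring A) (center_module A)"
  proof (rule M.submoduleI)
    show "?N \<subseteq> carrier (center_module A)" "\<zero>\<^bsub>center_module A\<^esub> \<in> ?N"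
      using S center_span_closed center_span_zero by (auto simp: center_module_def)
    show "\<ominus>\<^bsub>center_module A\<^esub> x \<in> ?N" if "x \<in> ?N" for x
      using center_span_scalar[OF S that, of "-1"] that center_span_closed[OF S(2)]
      by (simp add: inv smult_minus_one subset_iff)
  qed (use S in \<open>auto simp: center_module_def center_ring_def center_span_add center_span_mult\<close>)
  have N: "abelian_monoid (center_module A \<lparr>carrier := ?N\<rparr>)"
    using submodule.submodule_is_module[OF sub module_center_module]
    by (simp add: module_def abelian_group_def)
  show "fin_gen_module (center_ring A) (center_module A \<lparr>carrier := ?N\<rparr>)"
    unfolding fin_gen_module_def
  proof (intro exI[of _ S] conjI ballI S(1))
    show "S \<subseteq> carrier (center_module A \<lparr>carrier := ?N\<rparr>)"
      using center_span_superset[OF S] by auto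
    fix x assume "x \<in> carrier (center_module A \<lparr>carrier := ?N\<rparr>)"
    then obtain f where f: "f \<in> S \<rightarrow> cstar_center A" and x: "x = (\<Oplus>s\<in>S. f s \<otimes> s)"
      by (auto simp: center_span_def)
    have "(\<lambda>s. f s \<otimes> s) \<in> S \<rightarrow> ?N"
      using f S center_span_superset[OF S] center_span_mult[OF S] by (auto simp: Pi_iff)
    then have "x = finsum (center_module A \<lparr>carrier := ?N\<rparr>) (\<lambda>s. f s \<otimes> s) S"
      unfolding x using N coeff_closed[OF S(2) f]
      by (intro finsum_eq_if_same_addition) (auto simp: center_module_def abelian_monoid_axioms)
    then show "\<exists>f\<in>S \<rightarrow> carrier (center_ring A). x = (\<Oplus>\<^bsub>center_module A\<lparr>carrier := ?N\<rparr>\<^esub>s\<in>S.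
        f s \<odot>\<^bsub>center_module A\<lparr>carrier := ?N\<rparr>\<^esub> s)"
      using f by (intro bexI[of _ f]) (auto simp: center_module_def center_ring_def)
  qed
qed

lemma fin_gen_module_center_iff:
  "fin_gen_module (center_ring A) (center_module A) \<longleftrightarrow>
    (\<exists>S. finite S \<and> S \<subseteq> carrier A \<and> center_span S = carrier A)"
proof -
  interpret M: module "center_ring A" "center_module A" by (rule module_center_module)
  have eq: "(\<Oplus>\<^bsub>center_module A\<^esub>s\<in>S. f s \<odot>\<^bsub>center_module A\<^esub> s) = (\<Oplus>s\<in>S. f s \<otimes> s)"
    if "S \<subseteq> carrier A" "f \<in> S \<rightarrow> cstar_center A" for S f
    using coeff_closed[OF that]
    finsum_eq_if_same_addition[OF M.abelian_monoid_axioms abelian_monoid_axioms, of "\<lambda>s. f s \<otimes> s" S]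
    by (simp add: center_module_def)
  have "(\<forall>x\<in>carrier (center_module A). \<exists>f\<in>S \<rightarrow> carrier (center_ring A).
      x = (\<Oplus>\<^bsub>center_module A\<^esub>s\<in>S. f s \<odot>\<^bsub>center_module A\<^esub> s)) \<longleftrightarrow> center_span S = carrier A"
    if S: "S \<subseteq> carrier A" for S
  proof -
    have "center_span S = carrier A \<longleftrightarrow> (\<forall>x\<in>carrier A. \<exists>f\<in>S \<rightarrow> cstar_center A. x = (\<Oplus>s\<in>S. f s \<otimes> s))"
      using center_span_closed[OF S] by (auto simp: center_span_def)
    also have "\<dots> \<longleftrightarrow> (\<forall>x\<in>carrier (center_module A). \<exists>f\<in>S \<rightarrow> carrier (center_ring A).
      x = (\<Oplus>\<^bsub>center_module A\<^esub>s\<in>S. f s \<odot>\<^bsub>center_module A\<^esub> s))"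
      using eq[OF S] by (simp add: center_ring_def) (simp add: center_module_def)
    finally show ?thesis ..
  qed
  then show ?thesis
    unfolding fin_gen_module_def by (auto simp: center_module_def)
qed

lemma topologically_fin_gen_if_phases:
  assumes gen: "cstar_generated_by A G0" "G0 \<subseteq> G" and G: "G \<subseteq> carrier A" "adj A ` G \<subseteq> G" "finite G"
    and q: "q > 0"
    and phase: "\<And>g h. \<lbrakk>g \<in> G; h \<in> G\<rbrakk> \<Longrightarrow> \<exists>c. c ^ q = 1 \<and> h \<otimes> g = c \<odot> (g \<otimes> h)"
  shows "topologically_fin_gen_over_center A"
proof -
  obtain gs where gs: "set gs = G" using G(3) finite_list by blast
  have central: "g [^] q \<in> cstar_center A" if g: "g \<in> G" for g
  proof (rule central_if_commutes_generators[OF gen G(1,2)])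
    fix h assume h: "h \<in> G"
    then obtain c where "c ^ q = 1" "h \<otimes> g = c \<odot> (g \<otimes> h)" using phase[OF g h] by blast
    then show "g [^] q \<otimes> h = h \<otimes> g [^] q"
      using phase_commute_pow[of g h c q] subsetD[OF G(1) g] subsetD[OF G(1) h] by simp
  qed (use g G in auto)
  let ?W = "monomials q gs"
  have W: "finite ?W" "?W \<subseteq> carrier A"
    using finite_monomials monomials_closed[of gs] gs G by auto
  \<comment> \<open>The span contains the unit and absorbs left multiplication by letters, so it
    contains all words and inherits their density.\<close>
  have sub: "words_span A G \<subseteq> center_span ?W"
  proof
    fix x assume "x \<in> words_span A G"
    then show "x \<in> center_span ?W"
    proof induction
      case one
      then show ?case using W q by (intro center_span_superset one_in_monomials)
    next
      case (add x y)
      then show ?case using W by (simp add: center_span_add)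
    next
      case (scalar x c)
      then show ?case using W by (simp add: center_span_scalar)
    next
      case (mult g x)
      have "g \<otimes> w \<in> center_span ?W" if "w \<in> ?W" for w
      proof (rule monomials_left_mult)
        show "\<exists>c. h \<otimes> g = c \<odot> (g \<otimes> h)" if "g \<in> set gs" "h \<in> set gs" for g h
          using phase[of g h] that gs by blast
      qed (use mult(1) that gs G q central in simp_all)
      then show ?case
        by (rule center_span_left_mult[OF W W subsetD[OF G(1) mult(1)] _ mult.IH])
    qed
  qed
  have "carrier A \<subseteq> mtopology closure_of (center_span ?W)"
    using closure_of_mono[OF sub, of mtopology] generated_dense[OF gen G(1,2)] by simp
  then have "mtopology closure_of (center_span ?W) = carrier A"
    using closure_of_subset_topspace[of mtopology] by (simp add: subset_antisym)
  then show ?thesis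
    unfolding topologically_fin_gen_over_center_def using fin_gen_center_span[OF W] by blast
qed

text \<open>The centrality criterion is applied twice: the generators are central because they
  commute with each other, and then every element commutes with them and is central too. The algebra
  is its own center, generated by 1 as a module.\<close>

lemma fin_gen_if_commutative:
  assumes gen: "cstar_generated_by A G0" "G0 \<subseteq> G" and G: "G \<subseteq> carrier A" "adj A ` G \<subseteq> G"
    and comm: "\<And>g h. \<lbrakk>g \<in> G; h \<in> G\<rbrakk> \<Longrightarrow> h \<otimes> g = g \<otimes> h"
  shows "fin_gen_module (center_ring A) (center_module A)"
proof -
  have "G \<subseteq> cstar_center A"
    using G comm by (auto intro!: central_if_commutes_generators[OF gen G])
  then have "carrier A \<subseteq> cstar_center A"
    using G by (auto intro!: central_if_commutes_generators[OF gen G] simp: center_comm)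
  then have "x \<in> center_span {\<one>}" if "x \<in> carrier A" for x
    using center_span_mult[of "{\<one>}" x \<one>] center_span_superset[of "{\<one>}" \<one>] that by auto
  then show ?thesis
    unfolding fin_gen_module_center_iff using center_span_closed[of "{\<one>}"]
    by (intro exI[of _ "{\<one>}"]) auto
qed

section \<open>Phase relations between the sphere generators and their adjoints\<close>

lemma phase_sym:
  assumes "c ^ q = 1" "q > 0" "g \<in> carrier A" "h \<in> carrier A" "h \<otimes> g = c \<odot> (g \<otimes> h)"
  shows "\<exists>d. d ^ q = 1 \<and> g \<otimes> h = d \<odot> (h \<otimes> g)"
proof -
  have "c \<noteq> 0" using assms by (auto simp: zero_power)
  then show ?thesis
    using assms by (intro exI[of _ "inverse c"]) (simp add: power_inverse)
qed

text \<open>Of the four combinations of letters, two generators are covered by the relations and two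
  adjoints by taking adjoints. The mixed ones rest on Fuglede's theorem, whose unimodularity
  assumption holds because c^q = 1.\<close>

lemma sphere_phases:
  assumes t: "sphere_relations \<theta> A t" and q: "q > 0"
    and int: "\<And>i j. of_nat q * \<theta> $ i $ j \<in> \<int>"
    and "g \<in> range t \<union> adj A ` range t" "h \<in> range t \<union> adj A ` range t"
  shows "\<exists>c. c ^ q = 1 \<and> h \<otimes> g = c \<odot> (g \<otimes> h)"
proof -
  have tc: "t j \<in> carrier A" for j using t by (simp add: sphere_relations_def)
  have tt: "\<exists>c. c ^ q = 1 \<and> t k \<otimes> t j = c \<odot> (t j \<otimes> t k)" for j k
  proof -
    define c where "c = exp (2 * of_real pi * \<i> * of_real (\<theta> $ j $ k))"
    obtain m :: int where "of_nat q * \<theta> $ j $ k = of_int m"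
      using int[of j k] by (auto elim: Ints_cases)
    then have m: "complex_of_nat q * of_real (\<theta> $ j $ k) = of_int m"
      by (metis of_real_mult of_real_of_int_eq of_real_of_nat_eq)
    have "c ^ q = exp (2 * of_real pi * \<i> * (of_nat q * of_real (\<theta> $ j $ k)))"
      by (simp add: c_def mult_ac flip: exp_of_nat_mult)
    also have "\<dots> = 1" by (simp add: m exp_eq_1)
    finally show ?thesis
      using t unfolding sphere_relations_def c_def by blast
  qed
  have st: "\<exists>c. c ^ q = 1 \<and> adj A (t k) \<otimes> t j = c \<odot> (t j \<otimes> adj A (t k))" for j k
  proof -
    obtain c where c: "c ^ q = 1" "t k \<otimes> t j = c \<odot> (t j \<otimes> t k)" using tt by blast
    have "cmod c = 1"
      using power_eq_imp_eq_norm[of c q 1] c(1) q by simp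
    moreover have "adj A (t k) \<otimes> t k = t k \<otimes> adj A (t k)"
      using t by (simp add: sphere_relations_def)
    ultimately have "adj A (t k) \<otimes> t j = cnj c \<odot> (t j \<otimes> adj A (t k))"
      using Fuglede_phase tc c(2) by blast
    moreover have "cnj c ^ q = 1" using c(1) by (metis complex_cnj_one complex_cnj_power)
    ultimately show ?thesis by blast
  qed
  have ts: "\<exists>c. c ^ q = 1 \<and> t j \<otimes> adj A (t k) = c \<odot> (adj A (t k) \<otimes> t j)" for j k
    using st[of k j] phase_sym[OF _ q, of _ "t j" "adj A (t k)"] tc by auto
  have ss: "\<exists>c. c ^ q = 1 \<and> adj A (t k) \<otimes> adj A (t j) = c \<odot> (adj A (t j) \<otimes> adj A (t k))" for j k
  proof -
    obtain c where c: "c ^ q = 1" "t j \<otimes> t k = c \<odot> (t k \<otimes> t j)" using tt by blast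
    have "adj A (t k) \<otimes> adj A (t j) = cnj c \<odot> (adj A (t j) \<otimes> adj A (t k))"
      using arg_cong[OF c(2), of "adj A"] tc by (simp add: adj_mult adj_smult)
    moreover have "cnj c ^ q = 1" using c(1) by (metis complex_cnj_one complex_cnj_power)
    ultimately show ?thesis by blast
  qed
  show ?thesis
    using assms(4,5) tt st ts ss by auto
qed

end

lemma common_denominator:
  fixes \<theta> :: "real^'n^'m"
  assumes "\<forall>i j. \<theta> $ i $ j \<in> \<rat>"
  obtains q :: nat where "q > 0" "\<And>i j. of_nat q * \<theta> $ i $ j \<in> \<int>"
proof -
  have "\<exists>n::nat. n > 0 \<and> of_nat n * \<theta> $ i $ j \<in> \<int>" for i j
  proof -
    obtain a b :: int where "b > 0" "\<theta> $ i $ j = of_int a / of_int b"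
      using assms by (metis Rats_cases')
    then show ?thesis
      by (intro exI[of _ "nat b"]) auto
  qed
  then obtain n :: "'m \<Rightarrow> 'n \<Rightarrow> nat" where n: "\<And>i j. n i j > 0" "\<And>i j. of_nat (n i j) * \<theta> $ i $ j \<in> \<int>"
    by metis
  define q where "q = (\<Prod>p\<in>UNIV. n (fst p) (snd p))"
  have "q > 0" unfolding q_def using n by (simp add: prod_pos)
  moreover have "of_nat q * \<theta> $ i $ j \<in> \<int>" for i j
  proof -
    have "n i j dvd q"
      unfolding q_def using dvd_prodI[of UNIV "(i, j)" "\<lambda>p. n (fst p) (snd p)"] by simp
    then obtain m where "q = n i j * m" by blast
    then have "of_nat q * \<theta> $ i $ j = of_nat m * (of_nat (n i j) * \<theta> $ i $ j)" by simp
    then show ?thesis using n(2) by (metis Ints_mult Ints_of_nat)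
  qed
  ultimately show thesis by (rule that)
qed

section \<open>Matrix algebras\<close>

text \<open>Matrices are stored as functions on the reals, because the universal property is stated for
  test algebras of that type: the entry \<open>(i, j)\<close> is the value at \<open>prod_encode (i, j)\<close>.\<close>

definition entry :: "(real \<Rightarrow> complex) \<Rightarrow> nat \<Rightarrow> nat \<Rightarrow> complex" where
  "entry x i j = x (real (prod_encode (i, j)))"

text \<open>The value is zero at every real that does not encode a position in the q by q block, so
  each matrix has exactly one representative and equality can be checked entry by entry.\<close>

definition of_entries :: "nat \<Rightarrow> (nat \<Rightarrow> nat \<Rightarrow> complex) \<Rightarrow> real \<Rightarrow> complex" where
  "of_entries q f r = (let p = prod_decode (nat \<lfloor>r\<rfloor>) in
     if r = real (nat \<lfloor>r\<rfloor>) \<and> fst p < q \<and> snd p < q then f (fst p) (snd p) else 0)"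

lemma entry_of_entries [simp]: "entry (of_entries q f) i j = (if i < q \<and> j < q then f i j else 0)"
  by (simp add: entry_def of_entries_def Let_def)

lemma of_entries_eqI: "(\<And>i j. \<lbrakk>i < q; j < q\<rbrakk> \<Longrightarrow> f i j = g i j) \<Longrightarrow> of_entries q f = of_entries q g"
  by (auto simp: of_entries_def Let_def)

lemma range_of_entries_eqI:
  assumes "x \<in> range (of_entries q)" "y \<in> range (of_entries q)"
    and "\<And>i j. \<lbrakk>i < q; j < q\<rbrakk> \<Longrightarrow> entry x i j = entry y i j"
  shows "x = y"
  using assms by (auto intro!: of_entries_eqI)

section \<open>The operator norm on square matrices\<close>

definition vec_norm :: "nat \<Rightarrow> (nat \<Rightarrow> complex) \<Rightarrow> real" where
  "vec_norm q v = L2_set (\<lambda>i. cmod (v i)) {..<q}"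

definition mat_vec :: "nat \<Rightarrow> (nat \<Rightarrow> nat \<Rightarrow> complex) \<Rightarrow> (nat \<Rightarrow> complex) \<Rightarrow> nat \<Rightarrow> complex" where
  "mat_vec q M v i = (\<Sum>j<q. M i j * v j)"

text \<open>Vectors are functions on all naturals of which only the first q values count. The
  supremum therefore runs over the unit ball of a seminorm, which gives the usual operator norm of
  the q by q block.\<close>

definition op_norm :: "nat \<Rightarrow> (nat \<Rightarrow> nat \<Rightarrow> complex) \<Rightarrow> real" where
  "op_norm q M = (SUP v\<in>{v. vec_norm q v \<le> 1}. vec_norm q (mat_vec q M v))"

lemma vec_norm_nonneg [simp]: "0 \<le> vec_norm q v"
  by (simp add: vec_norm_def)

lemma vec_norm_scale: "vec_norm q (\<lambda>i. c * v i) = cmod c * vec_norm q v"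
  by (simp add: vec_norm_def norm_mult L2_set_right_distrib)

lemma vec_norm_add: "vec_norm q (\<lambda>i. u i + v i) \<le> vec_norm q u + vec_norm q v"
  unfolding vec_norm_def
  by (rule order_trans[OF L2_set_mono L2_set_triangle_ineq]) (auto intro: norm_triangle_ineq)

lemma vec_norm_cong: "(\<And>i. i < q \<Longrightarrow> u i = v i) \<Longrightarrow> vec_norm q u = vec_norm q v"
  unfolding vec_norm_def by (rule L2_set_cong) auto

lemma cmod_le_vec_norm: "i < q \<Longrightarrow> cmod (v i) \<le> vec_norm q v"
  unfolding vec_norm_def by (rule member_le_L2_set) auto

lemma cmod_inner_le: "cmod (\<Sum>i<q. cnj (u i) * v i) \<le> vec_norm q u * vec_norm q v"
proof -
  have "cmod (\<Sum>i<q. cnj (u i) * v i) \<le> (\<Sum>i<q. \<bar>cmod (u i)\<bar> * \<bar>cmod (v i)\<bar>)"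
    by (rule order_trans[OF norm_sum]) (simp add: norm_mult)
  also have "\<dots> \<le> vec_norm q u * vec_norm q v"
    unfolding vec_norm_def by (rule L2_set_mult_ineq)
  finally show ?thesis .
qed

text \<open>A crude bound, which makes the supremum in \<open>op_norm\<close> finite and later turns
  entrywise convergence into convergence in norm.\<close>

lemma vec_norm_mat_vec_le_sum: "vec_norm q (mat_vec q M v) \<le> (\<Sum>i<q. \<Sum>j<q. cmod (M i j)) * vec_norm q v"
proof -
  have "vec_norm q (mat_vec q M v) \<le> (\<Sum>i<q. cmod (mat_vec q M v i))"
    unfolding vec_norm_def by (rule L2_set_le_sum) auto
  also have "\<dots> \<le> (\<Sum>i<q. \<Sum>j<q. cmod (M i j) * vec_norm q v)"
    unfolding mat_vec_def
    by (intro sum_mono order_trans[OF norm_sum]) (auto simp: norm_mult intro!: mult_left_mono cmod_le_vec_norm)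
  finally show ?thesis by (simp add: sum_distrib_right)
qed

lemma op_norm_le:
  assumes "c \<ge> 0" "\<And>v. vec_norm q (mat_vec q M v) \<le> c * vec_norm q v"
  shows "op_norm q M \<le> c"
  unfolding op_norm_def
proof (rule cSUP_least)
  have "vec_norm q (\<lambda>_. 0) \<le> 1" by (simp add: vec_norm_def L2_set_def)
  then show "{v. vec_norm q v \<le> 1} \<noteq> {}" by blast
  fix v assume v: "v \<in> {v. vec_norm q v \<le> 1}"
  then have "c * vec_norm q v \<le> c" using assms(1) by (simp add: mult_left_le)
  then show "vec_norm q (mat_vec q M v) \<le> c" using assms(2)[of v] by linarith
qed

lemma op_norm_ge:
  assumes "vec_norm q v \<le> 1"
  shows "vec_norm q (mat_vec q M v) \<le> op_norm q M"
  unfolding op_norm_def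
proof (rule cSUP_upper)
  show "bdd_above ((\<lambda>v. vec_norm q (mat_vec q M v)) ` {v. vec_norm q v \<le> 1})"
  proof (rule bdd_aboveI2)
    fix v assume "v \<in> {v. vec_norm q v \<le> 1}"
    then show "vec_norm q (mat_vec q M v) \<le> (\<Sum>i<q. \<Sum>j<q. cmod (M i j))"
      by (intro order_trans[OF vec_norm_mat_vec_le_sum] mult_left_le) (auto intro!: sum_nonneg)
  qed
qed (use assms in auto)

lemma op_norm_nonneg: "0 \<le> op_norm q M"
  using op_norm_ge[of q "\<lambda>_. 0" M] by (simp add: vec_norm_def L2_set_def mat_vec_def)

lemma vec_norm_mat_vec_le: "vec_norm q (mat_vec q M v) \<le> op_norm q M * vec_norm q v"
proof (cases "vec_norm q v = 0")
  case True
  then show ?thesis using vec_norm_mat_vec_le_sum[of q M v] by simp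
next
  case False
  then have pos: "vec_norm q v > 0" by (simp add: order_less_le)
  define c where "c = complex_of_real (1 / vec_norm q v)"
  have c: "cmod c = 1 / vec_norm q v" by (simp add: c_def norm_divide)
  have "mat_vec q M (\<lambda>i. c * v i) = (\<lambda>i. c * mat_vec q M v i)"
    by (auto simp: mat_vec_def sum_distrib_left mult_ac)
  moreover have "vec_norm q (mat_vec q M (\<lambda>i. c * v i)) \<le> op_norm q M"
    using pos by (intro op_norm_ge) (simp add: vec_norm_scale c)
  ultimately show ?thesis
    using pos by (simp add: vec_norm_scale c field_simps)
qed

lemma op_norm_le_sum: "op_norm q M \<le> (\<Sum>i<q. \<Sum>j<q. cmod (M i j))"
  by (rule op_norm_le[OF _ vec_norm_mat_vec_le_sum]) (auto intro!: sum_nonneg)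

lemma op_norm_cong: "(\<And>i j. \<lbrakk>i < q; j < q\<rbrakk> \<Longrightarrow> M i j = N i j) \<Longrightarrow> op_norm q M = op_norm q N"
proof -
  assume *: "\<And>i j. \<lbrakk>i < q; j < q\<rbrakk> \<Longrightarrow> M i j = N i j"
  have "vec_norm q (mat_vec q M v) = vec_norm q (mat_vec q N v)" for v
    by (intro vec_norm_cong) (simp add: mat_vec_def *)
  then show ?thesis by (simp add: op_norm_def)
qed

lemma cmod_entry_le_op_norm:
  assumes "i < q" "j < q"
  shows "cmod (M i j) \<le> op_norm q M"
proof -
  define e where "e = (\<lambda>k. if k = j then 1 else 0 :: complex)"
  have "(\<Sum>k<q. (cmod (e k))\<^sup>2) = (\<Sum>k<q. if k = j then 1 else 0)"
    by (intro sum.cong) (auto simp: e_def)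
  then have e: "vec_norm q e = 1"
    using assms by (simp add: vec_norm_def L2_set_def)
  have "mat_vec q M e i = M i j"
    using assms unfolding mat_vec_def e_def by (simp add: if_distrib cong: if_cong)
  then show ?thesis
    using cmod_le_vec_norm[OF assms(1), of "mat_vec q M e"] op_norm_ge[of q e M] e by simp
qed

lemma op_norm_triangle: "op_norm q (\<lambda>i j. M i j + N i j) \<le> op_norm q M + op_norm q N"
proof (rule op_norm_le)
  fix v
  have "mat_vec q (\<lambda>i j. M i j + N i j) v = (\<lambda>i. mat_vec q M v i + mat_vec q N v i)"
    by (auto simp: mat_vec_def sum.distrib distrib_right)
  then show "vec_norm q (mat_vec q (\<lambda>i j. M i j + N i j) v) \<le> (op_norm q M + op_norm q N) * vec_norm q v"
    using vec_norm_add[of q "mat_vec q M v" "mat_vec q N v"] vec_norm_mat_vec_le[of q M v]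
      vec_norm_mat_vec_le[of q N v] by (simp add: distrib_right)
qed (simp add: op_norm_nonneg)

lemma op_norm_scale: "op_norm q (\<lambda>i j. c * M i j) = cmod c * op_norm q M"
proof -
  have *: "op_norm q (\<lambda>i j. c * M i j) \<le> cmod c * op_norm q M" for c M
  proof (rule op_norm_le)
    fix v
    have "mat_vec q (\<lambda>i j. c * M i j) v = (\<lambda>i. c * mat_vec q M v i)"
      by (auto simp: mat_vec_def sum_distrib_left mult_ac)
    then show "vec_norm q (mat_vec q (\<lambda>i j. c * M i j) v) \<le> cmod c * op_norm q M * vec_norm q v"
      by (simp add: vec_norm_scale vec_norm_mat_vec_le mult.assoc mult_left_mono)
  qed (simp add: op_norm_nonneg)
  show ?thesis
  proof (cases "c = 0")
    case True
    then show ?thesis using *[of c M] op_norm_nonneg[of q "\<lambda>i j. c * M i j"] by simp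
  next
    case False
    then have "op_norm q M \<le> cmod (inverse c) * op_norm q (\<lambda>i j. c * M i j)"
      using *[of "inverse c" "\<lambda>i j. c * M i j"] by (simp flip: mult.assoc)
    then have "cmod c * op_norm q M \<le> op_norm q (\<lambda>i j. c * M i j)"
      using False by (simp add: norm_divide field_simps)
    with *[of c M] show ?thesis by simp
  qed
qed

lemma mat_vec_mult:
  "mat_vec q (\<lambda>i j. \<Sum>k<q. M i k * N k j) v i = mat_vec q M (mat_vec q N v) i"
  unfolding mat_vec_def
  by (simp add: sum_distrib_left sum_distrib_right mult.assoc) (rule sum.swap)

lemma op_norm_mult: "op_norm q (\<lambda>i j. \<Sum>k<q. M i k * N k j) \<le> op_norm q M * op_norm q N"
proof (rule op_norm_le)
  fix v
  have "vec_norm q (mat_vec q M (mat_vec q N v)) \<le> op_norm q M * (op_norm q N * vec_norm q v)"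
    by (intro order_trans[OF vec_norm_mat_vec_le] mult_left_mono vec_norm_mat_vec_le op_norm_nonneg)
  moreover have "mat_vec q (\<lambda>i j. \<Sum>k<q. M i k * N k j) v = mat_vec q M (mat_vec q N v)"
    by (intro ext mat_vec_mult)
  ultimately show "vec_norm q (mat_vec q (\<lambda>i j. \<Sum>k<q. M i k * N k j) v) \<le> op_norm q M * op_norm q N * vec_norm q v"
    by (simp add: mult.assoc)
qed (simp add: op_norm_nonneg)

text \<open>The squared norm of M v is the inner product of v with M* M v, and the Cauchy-Schwarz
  inequality bounds it by ||M* M|| ||v||^2.\<close>

lemma op_norm_power2_le: "(op_norm q M)\<^sup>2 \<le> op_norm q (\<lambda>i j. \<Sum>k<q. cnj (M k i) * M k j)"
proof -
  define P where "P = (\<lambda>i j. \<Sum>k<q. cnj (M k i) * M k j)"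
  have "vec_norm q (mat_vec q M v) \<le> sqrt (op_norm q P) * vec_norm q v" for v
  proof -
    let ?u = "mat_vec q M v"
    have Pv: "mat_vec q P v j = (\<Sum>i<q. cnj (M i j) * ?u i)" for j
      using mat_vec_mult[of q "\<lambda>i k. cnj (M k i)" M v j] by (simp add: P_def mat_vec_def)
    have "complex_of_real ((vec_norm q ?u)\<^sup>2) = (\<Sum>i<q. cnj (?u i) * ?u i)"
      unfolding vec_norm_def L2_set_def
      by (subst real_sqrt_pow2) (auto simp: sum_nonneg complex_norm_square mult.commute simp del: of_real_power)
    also have "\<dots> = (\<Sum>i<q. \<Sum>j<q. cnj (v j) * (cnj (M i j) * ?u i))"
      by (subst (1) mat_vec_def) (simp add: sum_distrib_left sum_distrib_right mult_ac)
    also have "\<dots> = (\<Sum>j<q. cnj (v j) * mat_vec q P v j)"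
      unfolding Pv by (subst sum.swap) (simp add: sum_distrib_left)
    finally have "(vec_norm q ?u)\<^sup>2 = cmod (\<Sum>j<q. cnj (v j) * mat_vec q P v j)"
      by (metis abs_of_nonneg norm_of_real zero_le_power2)
    also have "\<dots> \<le> vec_norm q v * (op_norm q P * vec_norm q v)"
      by (intro order_trans[OF cmod_inner_le] mult_left_mono vec_norm_mat_vec_le) auto
    also have "\<dots> = (sqrt (op_norm q P) * vec_norm q v)\<^sup>2"
      by (simp add: power_mult_distrib op_norm_nonneg power2_eq_square)
    finally show ?thesis
      by (rule power2_le_imp_le) (simp add: op_norm_nonneg)
  qed
  then have "op_norm q M \<le> sqrt (op_norm q P)"
    by (intro op_norm_le) (simp add: op_norm_nonneg)
  then have "(op_norm q M)\<^sup>2 \<le> (sqrt (op_norm q P))\<^sup>2"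
    by (intro power_mono op_norm_nonneg)
  then show ?thesis by (simp add: op_norm_nonneg P_def)
qed

text \<open>From ||M||^2 <= ||M* M|| <= ||M*|| ||M|| one factor ||M|| cancels, and exchanging M and
  M* gives the other inequality.\<close>

lemma op_norm_adj: "op_norm q (\<lambda>i j. cnj (M j i)) = op_norm q M"
proof -
  have *: "op_norm q M \<le> op_norm q (\<lambda>i j. cnj (M j i))" for M
  proof (cases "op_norm q M = 0")
    case False
    have "op_norm q M * op_norm q M \<le> op_norm q (\<lambda>i j. cnj (M j i)) * op_norm q M"
      using op_norm_power2_le[of q M] op_norm_mult[of q "\<lambda>i j. cnj (M j i)" M]
      by (simp add: power2_eq_square)
    with False show ?thesis
      using op_norm_nonneg[of q M] by (simp add: order_less_le)
  qed (simp add: op_norm_nonneg)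
  show ?thesis using *[of M] *[of "\<lambda>i j. cnj (M j i)"] by simp
qed

lemma op_norm_cstar: "op_norm q (\<lambda>i j. \<Sum>k<q. cnj (M k i) * M k j) = (op_norm q M)\<^sup>2"
  using op_norm_power2_le[of q M] op_norm_mult[of q "\<lambda>i j. cnj (M j i)" M]
  by (simp add: op_norm_adj power2_eq_square)

section \<open>The C*-algebra of square matrices\<close>

definition matrix_cstar :: "nat \<Rightarrow> (real \<Rightarrow> complex) cstar" where
  "matrix_cstar q = \<lparr>carrier = range (of_entries q),
     monoid.mult = (\<lambda>x y. of_entries q (\<lambda>i j. \<Sum>k<q. entry x i k * entry y k j)),
     one = of_entries q (\<lambda>i j. if i = j then 1 else 0),
     zero = of_entries q (\<lambda>i j. 0),
     add = (\<lambda>x y. of_entries q (\<lambda>i j. entry x i j + entry y i j)),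
     smult = (\<lambda>c x. of_entries q (\<lambda>i j. c * entry x i j)),
     adj = (\<lambda>x. of_entries q (\<lambda>i j. cnj (entry x j i))),
     nrm = (\<lambda>x. op_norm q (entry x))\<rparr>"

lemma matrix_cstar_closed [simp]: "of_entries q f \<in> carrier (matrix_cstar q)"
  by (simp add: matrix_cstar_def)

lemma entry_matrix_cstar [simp]:
  assumes "i < q" "j < q"
  shows "entry (x \<otimes>\<^bsub>matrix_cstar q\<^esub> y) i j = (\<Sum>k<q. entry x i k * entry y k j)"
    and "entry \<one>\<^bsub>matrix_cstar q\<^esub> i j = (if i = j then 1 else 0)"
    and "entry \<zero>\<^bsub>matrix_cstar q\<^esub> i j = 0"
    and "entry (x \<oplus>\<^bsub>matrix_cstar q\<^esub> y) i j = entry x i j + entry y i j"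
    and "entry (c \<odot>\<^bsub>matrix_cstar q\<^esub> x) i j = c * entry x i j"
    and "entry (adj (matrix_cstar q) x) i j = cnj (entry x j i)"
  using assms by (simp_all add: matrix_cstar_def)

text \<open>Every operation passes its result through \<open>of_entries\<close>, so the result lies
  in the carrier for arbitrary arguments.\<close>

lemma matrix_cstar_ops_closed:
  "x \<otimes>\<^bsub>matrix_cstar q\<^esub> y \<in> carrier (matrix_cstar q)" "\<one>\<^bsub>matrix_cstar q\<^esub> \<in> carrier (matrix_cstar q)"
  "\<zero>\<^bsub>matrix_cstar q\<^esub> \<in> carrier (matrix_cstar q)" "x \<oplus>\<^bsub>matrix_cstar q\<^esub> y \<in> carrier (matrix_cstar q)"
  "c \<odot>\<^bsub>matrix_cstar q\<^esub> x \<in> carrier (matrix_cstar q)" "adj (matrix_cstar q) x \<in> carrier (matrix_cstar q)"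
  by (simp_all add: matrix_cstar_def)

lemma matrix_cstar_eqI:
  assumes "x \<in> carrier (matrix_cstar q)" "y \<in> carrier (matrix_cstar q)"
    and "\<And>i j. \<lbrakk>i < q; j < q\<rbrakk> \<Longrightarrow> entry x i j = entry y i j"
  shows "x = y"
  using range_of_entries_eqI[of x q y] assms by (simp add: matrix_cstar_def)

lemma nrm_matrix_cstar: "nrm (matrix_cstar q) x = op_norm q (entry x)"
  by (simp add: matrix_cstar_def)

lemma sum_mult_delta:
  fixes f :: "nat \<Rightarrow> complex"
  assumes "i < q"
  shows "(\<Sum>k<q. (if i = k then 1 else 0) * f k) = f i" "(\<Sum>k<q. f k * (if k = i then 1 else 0)) = f i"
proof -
  have "(\<Sum>k<q. (if i = k then 1 else 0) * f k) = (\<Sum>k<q. if k = i then f k else 0)"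
    by (intro sum.cong) auto
  moreover have "(\<Sum>k<q. f k * (if k = i then 1 else 0)) = (\<Sum>k<q. if k = i then f k else 0)"
    by (intro sum.cong) auto
  ultimately show "(\<Sum>k<q. (if i = k then 1 else 0) * f k) = f i"
    "(\<Sum>k<q. f k * (if k = i then 1 else 0)) = f i"
    using assms by simp_all
qed

lemma ring_matrix_cstar: "ring (matrix_cstar q)"
proof (rule ringI)
  show "abelian_group (matrix_cstar q)"
  proof (rule abelian_groupI)
    fix x assume x: "x \<in> carrier (matrix_cstar q)"
    show "\<exists>y\<in>carrier (matrix_cstar q). y \<oplus>\<^bsub>matrix_cstar q\<^esub> x = \<zero>\<^bsub>matrix_cstar q\<^esub>"
      by (rule bexI[of _ "(-1) \<odot>\<^bsub>matrix_cstar q\<^esub> x"])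
        (auto intro!: matrix_cstar_eqI[of _ q] matrix_cstar_ops_closed)
  qed (auto intro!: matrix_cstar_eqI[of _ q] matrix_cstar_ops_closed simp: algebra_simps)
  show "monoid (matrix_cstar q)"
  proof (rule monoidI)
    fix x y z
    show "x \<otimes>\<^bsub>matrix_cstar q\<^esub> y \<otimes>\<^bsub>matrix_cstar q\<^esub> z = x \<otimes>\<^bsub>matrix_cstar q\<^esub> (y \<otimes>\<^bsub>matrix_cstar q\<^esub> z)"
    proof (rule matrix_cstar_eqI[of _ q]; (rule matrix_cstar_ops_closed)?)
      fix i j assume ij: "i < q" "j < q"
      have "(\<Sum>k<q. (\<Sum>l<q. entry x i l * entry y l k) * entry z k j) =
          (\<Sum>k<q. \<Sum>l<q. entry x i l * (entry y l k * entry z k j))"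
        by (simp add: sum_distrib_right mult.assoc)
      also have "\<dots> = (\<Sum>l<q. \<Sum>k<q. entry x i l * (entry y l k * entry z k j))"
        by (rule sum.swap)
      finally show "entry (x \<otimes>\<^bsub>matrix_cstar q\<^esub> y \<otimes>\<^bsub>matrix_cstar q\<^esub> z) i j =
          entry (x \<otimes>\<^bsub>matrix_cstar q\<^esub> (y \<otimes>\<^bsub>matrix_cstar q\<^esub> z)) i j"
        using ij by (simp add: sum_distrib_left)
    qed
  qed (auto intro!: matrix_cstar_eqI[of _ q] matrix_cstar_ops_closed simp: sum_mult_delta)
qed (auto intro!: matrix_cstar_eqI[of _ q] matrix_cstar_ops_closed simp: algebra_simps sum.distrib)

lemma entry_minus_matrix_cstar:
  assumes "x \<in> carrier (matrix_cstar q)" "y \<in> carrier (matrix_cstar q)" "i < q" "j < q"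
  shows "entry (x \<ominus>\<^bsub>matrix_cstar q\<^esub> y) i j = entry x i j - entry y i j"
proof -
  interpret ring "matrix_cstar q" by (rule ring_matrix_cstar)
  have "(-1) \<odot>\<^bsub>matrix_cstar q\<^esub> y \<oplus>\<^bsub>matrix_cstar q\<^esub> y = \<zero>\<^bsub>matrix_cstar q\<^esub>"
    by (rule matrix_cstar_eqI[of _ q]) (auto intro!: matrix_cstar_ops_closed)
  then have "\<ominus>\<^bsub>matrix_cstar q\<^esub> y = (-1) \<odot>\<^bsub>matrix_cstar q\<^esub> y"
    using assms by (intro minus_equality matrix_cstar_ops_closed) auto
  then show ?thesis
    using assms by (simp add: a_minus_def)
qed

text \<open>Established ahead of the C*-algebra instance, since completeness is one of its axioms
  and refers to this metric.\<close>

lemma Metric_space_matrix_cstar: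
  "Metric_space (carrier (matrix_cstar q)) (nrm_dist (matrix_cstar q))"
proof -
  let ?A = "matrix_cstar q"
  interpret ring ?A by (rule ring_matrix_cstar)
  have dist: "nrm_dist ?A x y = op_norm q (\<lambda>i j. entry x i j - entry y i j)"
    if "x \<in> carrier ?A" "y \<in> carrier ?A" for x y
    using that by (auto simp: nrm_dist_def nrm_matrix_cstar entry_minus_matrix_cstar intro!: op_norm_cong)
  show ?thesis
  proof
    fix x y z
    show "0 \<le> nrm_dist ?A x y"
      by (simp add: nrm_dist_def nrm_matrix_cstar op_norm_nonneg)
    show "nrm_dist ?A x y = nrm_dist ?A y x"
    proof (cases "x \<in> carrier ?A \<and> y \<in> carrier ?A")
      case True
      then show ?thesis
        using op_norm_scale[of q "-1" "\<lambda>i j. entry x i j - entry y i j"] by (simp add: dist)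
    qed (auto simp: nrm_dist_def)
    assume x: "x \<in> carrier ?A" and y: "y \<in> carrier ?A"
    show "nrm_dist ?A x y = 0 \<longleftrightarrow> x = y"
    proof
      assume "nrm_dist ?A x y = 0"
      then have "cmod (entry x i j - entry y i j) \<le> 0" if "i < q" "j < q" for i j
        using cmod_entry_le_op_norm[OF that, of "\<lambda>i j. entry x i j - entry y i j"] x y by (simp add: dist)
      then show "x = y" using x y by (intro matrix_cstar_eqI[of _ q]) auto
    next
      assume "x = y"
      then show "nrm_dist ?A x y = 0"
        using op_norm_scale[of q 0 "\<lambda>i j. 0"] y by (simp add: dist)
    qed
    assume z: "z \<in> carrier ?A"
    show "nrm_dist ?A x z \<le> nrm_dist ?A x y + nrm_dist ?A y z"
      using op_norm_triangle[of q "\<lambda>i j. entry x i j - entry y i j" "\<lambda>i j. entry y i j - entry z i j"] x y z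
      by (simp add: dist)
  qed
qed

text \<open>Entries are dominated by the operator norm, so a Cauchy sequence converges entrywise;
  the operator norm is dominated by the sum of the entries, so it also converges in norm.\<close>

lemma mcomplete_matrix_cstar:
  "Metric_space.mcomplete (carrier (matrix_cstar q)) (nrm_dist (matrix_cstar q))"
proof -
  let ?A = "matrix_cstar q"
  interpret ring ?A by (rule ring_matrix_cstar)
  interpret Metric_space "carrier ?A" "nrm_dist ?A" by (rule Metric_space_matrix_cstar)
  have dist: "nrm_dist ?A x y = op_norm q (\<lambda>i j. entry x i j - entry y i j)"
    if "x \<in> carrier ?A" "y \<in> carrier ?A" for x y
    using that by (auto simp: nrm_dist_def nrm_matrix_cstar entry_minus_matrix_cstar intro!: op_norm_cong)
  show ?thesis
    unfolding mcomplete_def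
  proof (intro allI impI)
    fix \<sigma> assume C: "MCauchy \<sigma>"
    then have \<sigma>: "\<sigma> n \<in> carrier ?A" for n
      by (auto simp: MCauchy_def)
    have "convergent (\<lambda>n. entry (\<sigma> n) i j)" if ij: "i < q" "j < q" for i j
    proof -
      have "Cauchy (\<lambda>n. entry (\<sigma> n) i j)"
      proof (rule metric_CauchyI)
        fix e :: real assume "e > 0"
        then obtain N where N: "\<And>m n. \<lbrakk>N \<le> m; N \<le> n\<rbrakk> \<Longrightarrow> nrm_dist ?A (\<sigma> m) (\<sigma> n) < e"
          using C unfolding MCauchy_def by meson
        have "dist (entry (\<sigma> m) i j) (entry (\<sigma> n) i j) < e" if "N \<le> m" "N \<le> n" for m n
          using N[OF that] cmod_entry_le_op_norm[OF ij, of "\<lambda>i j. entry (\<sigma> m) i j - entry (\<sigma> n) i j"]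
          by (simp add: dist_norm dist[OF \<sigma> \<sigma>])
        then show "\<exists>N. \<forall>m\<ge>N. \<forall>n\<ge>N. dist (entry (\<sigma> m) i j) (entry (\<sigma> n) i j) < e" by blast
      qed
      then show ?thesis by (rule Cauchy_convergent)
    qed
    then obtain L where L: "\<And>i j. \<lbrakk>i < q; j < q\<rbrakk> \<Longrightarrow> (\<lambda>n. entry (\<sigma> n) i j) \<longlonglongrightarrow> L i j"
      unfolding convergent_def by metis
    define l where "l = of_entries q L"
    have l: "l \<in> carrier ?A" by (simp add: l_def)
    have "(\<lambda>n. \<Sum>i<q. \<Sum>j<q. cmod (entry (\<sigma> n) i j - L i j)) \<longlonglongrightarrow> (\<Sum>i<q. \<Sum>j<q. cmod (L i j - L i j))"
      by (intro tendsto_intros L) auto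
    then have lim: "(\<lambda>n. \<Sum>i<q. \<Sum>j<q. cmod (entry (\<sigma> n) i j - L i j)) \<longlonglongrightarrow> 0" by simp
    have bound: "nrm_dist ?A (\<sigma> n) l \<le> (\<Sum>i<q. \<Sum>j<q. cmod (entry (\<sigma> n) i j - L i j))" for n
      using op_norm_le_sum[of q "\<lambda>i j. entry (\<sigma> n) i j - entry l i j"]
      unfolding dist[OF \<sigma> l] by (simp add: l_def)
    have "limitin mtopology \<sigma> l sequentially"
      unfolding limitin_metric
    proof (intro conjI l allI impI)
      fix e :: real assume "e > 0"
      from order_tendstoD(2)[OF lim this]
      show "\<forall>\<^sub>F n in sequentially. \<sigma> n \<in> carrier ?A \<and> nrm_dist ?A (\<sigma> n) l < e"
        by eventually_elim (use \<sigma> bound in \<open>auto intro: le_less_trans\<close>)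
    qed
    then show "\<exists>x. limitin mtopology \<sigma> x sequentially" by blast
  qed
qed

lemma unital_cstar_algebra_matrix_cstar: "unital_cstar_algebra (matrix_cstar q)"
proof -
  let ?A = "matrix_cstar q"
  note eqI = matrix_cstar_eqI[of _ q]
  interpret ring ?A by (rule ring_matrix_cstar)
  have "Module.module ring_of_type_algebra ?A"
    by (rule moduleI[OF cring_from_type_algebra])
      (auto intro!: eqI matrix_cstar_ops_closed is_abelian_group
        simp: ring_of_type_algebra_def algebra_simps)
  moreover have "unital_cstar_algebra_axioms ?A"
  proof
    fix x y c
    show "c \<odot>\<^bsub>?A\<^esub> x \<otimes>\<^bsub>?A\<^esub> y = c \<odot>\<^bsub>?A\<^esub> (x \<otimes>\<^bsub>?A\<^esub> y)"
      by (auto intro!: eqI matrix_cstar_ops_closed simp: sum_distrib_left mult_ac)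
    show "x \<otimes>\<^bsub>?A\<^esub> (c \<odot>\<^bsub>?A\<^esub> y) = c \<odot>\<^bsub>?A\<^esub> (x \<otimes>\<^bsub>?A\<^esub> y)"
      by (auto intro!: eqI matrix_cstar_ops_closed simp: sum_distrib_left mult_ac)
    show "adj ?A x \<in> carrier ?A" by (rule matrix_cstar_ops_closed)
    show "adj ?A (adj ?A x) = x" if "x \<in> carrier ?A"
      using that by (auto intro!: eqI matrix_cstar_ops_closed)
    show "adj ?A (x \<oplus>\<^bsub>?A\<^esub> y) = adj ?A x \<oplus>\<^bsub>?A\<^esub> adj ?A y"
      by (auto intro!: eqI matrix_cstar_ops_closed)
    show "adj ?A (c \<odot>\<^bsub>?A\<^esub> x) = cnj c \<odot>\<^bsub>?A\<^esub> adj ?A x"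
      by (auto intro!: eqI matrix_cstar_ops_closed)
    show "adj ?A (x \<otimes>\<^bsub>?A\<^esub> y) = adj ?A y \<otimes>\<^bsub>?A\<^esub> adj ?A x"
      by (auto intro!: eqI matrix_cstar_ops_closed simp: mult.commute)
    show "nrm ?A x = 0 \<longleftrightarrow> x = \<zero>\<^bsub>?A\<^esub>" if "x \<in> carrier ?A"
    proof -
      have "nrm_dist ?A x \<zero>\<^bsub>?A\<^esub> = nrm ?A x"
        using that by (simp add: nrm_dist_def a_minus_def)
      then show ?thesis
        using Metric_space.zero[OF Metric_space_matrix_cstar that, of "\<zero>\<^bsub>?A\<^esub>"] by simp
    qed
    show "nrm ?A (x \<oplus>\<^bsub>?A\<^esub> y) \<le> nrm ?A x + nrm ?A y"
      using op_norm_triangle[of q "entry x" "entry y"]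
        op_norm_cong[of q "entry (x \<oplus>\<^bsub>?A\<^esub> y)" "\<lambda>i j. entry x i j + entry y i j"]
      by (simp add: nrm_matrix_cstar)
    show "nrm ?A (c \<odot>\<^bsub>?A\<^esub> x) = cmod c * nrm ?A x"
      using op_norm_scale[of q c "entry x"]
        op_norm_cong[of q "entry (c \<odot>\<^bsub>?A\<^esub> x)" "\<lambda>i j. c * entry x i j"]
      by (simp add: nrm_matrix_cstar)
    show "nrm ?A (x \<otimes>\<^bsub>?A\<^esub> y) \<le> nrm ?A x * nrm ?A y"
      using op_norm_mult[of q "entry x" "entry y"]
        op_norm_cong[of q "entry (x \<otimes>\<^bsub>?A\<^esub> y)" "\<lambda>i j. \<Sum>k<q. entry x i k * entry y k j"]
      by (simp add: nrm_matrix_cstar)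
    show "nrm ?A (adj ?A x \<otimes>\<^bsub>?A\<^esub> x) = (nrm ?A x)\<^sup>2"
      using op_norm_cstar[of q "entry x"]
        op_norm_cong[of q "entry (adj ?A x \<otimes>\<^bsub>?A\<^esub> x)" "\<lambda>i j. \<Sum>k<q. cnj (entry x k i) * entry x k j"]
      by (simp add: nrm_matrix_cstar)
  qed (rule mcomplete_matrix_cstar)
  ultimately show ?thesis
    by (intro unital_cstar_algebra.intro ring_matrix_cstar)
qed

section \<open>Representations by matrices\<close>

context unital_cstar_algebra
begin

text \<open>For \<open>p = a* a\<close> of norm at most \<open>1/4\<close> the square root of \<open>1 - p\<close> is \<open>1 - y\<close>, where \<open>y\<close> is the
  fixed point of the contraction \<open>y \<mapsto> (p + y\<^sup>2) / 2\<close>.\<close>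

lemma complement_of_square:
  assumes a: "a \<in> carrier A" "nrm A a \<le> 1/2"
  obtains k where "k \<in> carrier A" "adj A a \<otimes> a \<oplus> adj A k \<otimes> k = \<one>"
proof -
  define p where "p = adj A a \<otimes> a"
  have p: "p \<in> carrier A" "adj A p = p"
    using a by (simp_all add: p_def adj_mult)
  have np: "nrm A p \<le> 1/4"
    using a power_mono[OF a(2), of 2] nrm_nonneg by (simp add: p_def nrm_cstar power2_eq_square)
  \<comment> \<open>On this ball f has norm at most (1/4 + 1/4) / 2, and its Lipschitz constant is
    at most (1/2 + 1/2) / 2 = 1/2.\<close>
  define M where "M = mcball \<zero> (1/2)"
  have M_iff: "y \<in> M \<longleftrightarrow> y \<in> carrier A \<and> nrm A y \<le> 1/2" for y
    using nrm_minus_commute[of \<zero> y] by (auto simp: M_def nrm_dist_def a_minus_def)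
  have sub: "M \<subseteq> carrier A" by (auto simp: M_iff)
  interpret M: Metric_space M "nrm_dist A" by (rule subspace[OF sub])
  have "Submetric (carrier A) (nrm_dist A) M"
    by (intro Submetric.intro Submetric_axioms.intro sub Metric_space_axioms)
  then have "M.mcomplete"
    using closedin_mcball complete unfolding M_def by (rule Submetric.closedin_mcomplete_imp_mcomplete)
  define f where "f y = (1/2) \<odot> (p \<oplus> y \<otimes> y)" for y
  have f: "f \<in> M \<rightarrow> M"
  proof
    fix y assume y: "y \<in> M"
    then have "nrm A (y \<otimes> y) \<le> 1/2 * (1/2)"
      by (intro nrm_mult_le) (auto simp: M_iff)
    then show "f y \<in> M"
      using y p np nrm_triangle[of p "y \<otimes> y"] by (simp add: M_iff f_def nrm_smult norm_divide)
  qed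
  have contraction: "nrm_dist A (f x) (f y) \<le> 1/2 * nrm_dist A x y" if "x \<in> M" "y \<in> M" for x y
  proof -
    have xy: "x \<in> carrier A" "y \<in> carrier A" "nrm A x \<le> 1/2" "nrm A y \<le> 1/2"
      using that by (auto simp: M_iff)
    have "f x \<ominus> f y = (1/2) \<odot> ((p \<oplus> x \<otimes> x) \<ominus> (p \<oplus> y \<otimes> y))"
      using xy p by (simp add: f_def minus_eq_scalar scalar_distrib)
    also have "\<dots> = (1/2) \<odot> (x \<otimes> x \<ominus> y \<otimes> y)"
      using xy p by (simp add: minus_cancel_left)
    finally have "nrm A (f x \<ominus> f y) = 1/2 * nrm A (x \<otimes> x \<ominus> y \<otimes> y)"
      using xy by (simp add: nrm_smult norm_divide)
    also have "x \<otimes> x \<ominus> y \<otimes> y = (x \<ominus> y) \<otimes> x \<oplus> y \<otimes> (x \<ominus> y)"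
      using xy by (simp add: mult_minus_mult)
    also have "nrm A \<dots> \<le> nrm A (x \<ominus> y) * (1/2) + 1/2 * nrm A (x \<ominus> y)"
      using xy by (intro order_trans[OF nrm_triangle] add_mono nrm_mult_le) auto
    finally show ?thesis
      using xy p by (simp add: nrm_dist_def f_def)
  qed
  have "M \<noteq> {}" using M_iff[of \<zero>] by auto
  then obtain y where y: "y \<in> M" "f y = y"
    using M.Banach_fixedpoint_thm[OF \<open>M.mcomplete\<close> _ f _ contraction, of thesis] by auto
  have yc: "y \<in> carrier A" using y sub by auto
  \<comment> \<open>Since p is self-adjoint, the adjoint of y is again a fixed point in the ball,
    and uniqueness makes y self-adjoint.\<close>
  have "f (adj A y) = adj A (f y)"
    using yc p by (simp add: f_def adj_smult adj_add adj_mult)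
  then have y_adj: "adj A y = y"
    using y yc by (intro M.contraction_imp_unique_fixpoint[OF _ y(2) f _ contraction]) (auto simp: M_iff)
  have "2 \<odot> f y = p \<oplus> y \<otimes> y"
    using yc p by (simp add: f_def)
  then have yy: "p \<oplus> y \<otimes> y = 2 \<odot> y" using y by simp
  have "adj A (\<one> \<ominus> y) \<otimes> (\<one> \<ominus> y) = \<one> \<oplus> (y \<otimes> y \<ominus> 2 \<odot> y)"
    using yc scalar_add[of y 1 1] y_adj scalar_add[of y "-1" "-1"]
    by (simp add: minus_eq_scalar adj_add adj_smult l_distr r_distr smult_mult_left smult_mult_right
        scalar_distrib a_ac)
  then have "p \<oplus> adj A (\<one> \<ominus> y) \<otimes> (\<one> \<ominus> y) = \<one> \<oplus> ((p \<oplus> y \<otimes> y) \<ominus> 2 \<odot> y)"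
    using yc p by (simp add: a_minus_def a_ac)
  then have "p \<oplus> adj A (\<one> \<ominus> y) \<otimes> (\<one> \<ominus> y) = \<one>"
    unfolding yy using yc by (simp add: a_minus_def r_neg)
  then show thesis
    using that[of "\<one> \<ominus> y"] yc by (simp add: p_def)
qed

end

locale matrix_representation = unital_cstar_algebra A for A :: "'a cstar" (structure) +
  fixes q :: nat and \<phi> :: "'a \<Rightarrow> real \<Rightarrow> complex"
  assumes hom: "\<phi> \<in> unital_star_hom A (matrix_cstar q)"
begin

lemma rep_ring_hom: "\<phi> \<in> ring_hom A (matrix_cstar q)"
  using hom by (simp add: unital_star_hom_def)

lemma rep_closed: "x \<in> carrier A \<Longrightarrow> \<phi> x \<in> carrier (matrix_cstar q)"
  by (rule ring_hom_closed[OF rep_ring_hom])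

lemma rep_mult: "\<lbrakk>x \<in> carrier A; y \<in> carrier A\<rbrakk> \<Longrightarrow> \<phi> (x \<otimes> y) = \<phi> x \<otimes>\<^bsub>matrix_cstar q\<^esub> \<phi> y"
  by (rule ring_hom_mult[OF rep_ring_hom])

lemma rep_add: "\<lbrakk>x \<in> carrier A; y \<in> carrier A\<rbrakk> \<Longrightarrow> \<phi> (x \<oplus> y) = \<phi> x \<oplus>\<^bsub>matrix_cstar q\<^esub> \<phi> y"
  by (rule ring_hom_add[OF rep_ring_hom])

lemma rep_one: "\<phi> \<one> = \<one>\<^bsub>matrix_cstar q\<^esub>"
  by (rule ring_hom_one[OF rep_ring_hom])

lemma rep_scalar: "x \<in> carrier A \<Longrightarrow> \<phi> (c \<odot> x) = c \<odot>\<^bsub>matrix_cstar q\<^esub> \<phi> x"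
  using hom by (simp add: unital_star_hom_def)

lemma rep_adj: "x \<in> carrier A \<Longrightarrow> \<phi> (adj A x) = adj (matrix_cstar q) (\<phi> x)"
  using hom by (simp add: unital_star_hom_def)

lemma rep_pow: "x \<in> carrier A \<Longrightarrow> \<phi> (x [^] (n::nat)) = \<phi> x [^]\<^bsub>matrix_cstar q\<^esub> n"
  by (induction n) (simp_all add: rep_one rep_mult)

context
  fixes i j assumes ij: "i < q" "j < q"
begin

lemma entry_rep_mult:
  "\<lbrakk>x \<in> carrier A; y \<in> carrier A\<rbrakk> \<Longrightarrow> entry (\<phi> (x \<otimes> y)) i j = (\<Sum>k<q. entry (\<phi> x) i k * entry (\<phi> y) k j)"
  using ij by (simp add: rep_mult)

lemma entry_rep_add:
  "\<lbrakk>x \<in> carrier A; y \<in> carrier A\<rbrakk> \<Longrightarrow> entry (\<phi> (x \<oplus> y)) i j = entry (\<phi> x) i j + entry (\<phi> y) i j"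
  using ij by (simp add: rep_add)

lemma entry_rep_scalar: "x \<in> carrier A \<Longrightarrow> entry (\<phi> (c \<odot> x)) i j = c * entry (\<phi> x) i j"
  using ij by (simp add: rep_scalar)

lemma entry_rep_adj: "x \<in> carrier A \<Longrightarrow> entry (\<phi> (adj A x)) i j = cnj (entry (\<phi> x) j i)"
  using ij by (simp add: rep_adj)

lemma entry_rep_one: "entry (\<phi> \<one>) i j = (if i = j then 1 else 0)"
  using ij by (simp add: rep_one)

lemma entry_rep_zero: "entry (\<phi> \<zero>) i j = 0"
  using entry_rep_scalar[of \<zero> 0] by simp

lemma entry_rep_minus:
  "\<lbrakk>x \<in> carrier A; y \<in> carrier A\<rbrakk> \<Longrightarrow> entry (\<phi> (x \<ominus> y)) i j = entry (\<phi> x) i j - entry (\<phi> y) i j"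
  by (simp add: minus_eq_scalar entry_rep_add entry_rep_scalar)

text \<open>For ||b|| <= 1/2 some k satisfies b* b + k* k = 1. The (j, j) entry of the image of this
  equation says that the squared entries of column j of b and of k add up to 1. Scaling a to norm
  1/2 produces the factor 2. The bound does not depend on the representation.\<close>

lemma cmod_entry_rep_le:
  assumes a: "a \<in> carrier A"
  shows "cmod (entry (\<phi> a) i j) \<le> 2 * nrm A a"
proof -
  have small: "cmod (entry (\<phi> b) i j) \<le> 1" if b: "b \<in> carrier A" "nrm A b \<le> 1/2" for b
  proof -
    obtain k where k: "k \<in> carrier A" "adj A b \<otimes> b \<oplus> adj A k \<otimes> k = \<one>"
      using complement_of_square[OF b] .
    have square: "entry (\<phi> (adj A x \<otimes> x)) j j = of_real (\<Sum>l<q. (cmod (entry (\<phi> x) l j))\<^sup>2)"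
      if "x \<in> carrier A" for x
      using that ij rep_adj[of x] by (simp add: rep_mult complex_norm_square mult.commute del: of_real_power)
    have "entry (\<phi> (adj A b \<otimes> b \<oplus> adj A k \<otimes> k)) j j =
        entry (\<phi> (adj A b \<otimes> b)) j j + entry (\<phi> (adj A k \<otimes> k)) j j"
      using b(1) k(1) ij by (simp add: rep_add)
    moreover have "entry (\<phi> (adj A b \<otimes> b \<oplus> adj A k \<otimes> k)) j j = 1"
      unfolding k(2) using ij by (simp add: rep_one)
    ultimately have "complex_of_real ((\<Sum>l<q. (cmod (entry (\<phi> b) l j))\<^sup>2) + (\<Sum>l<q. (cmod (entry (\<phi> k) l j))\<^sup>2)) = of_real 1"
      using square[OF k(1)] square[OF b(1)] by (simp del: of_real_power of_real_sum)
    then have "(\<Sum>l<q. (cmod (entry (\<phi> b) l j))\<^sup>2) + (\<Sum>l<q. (cmod (entry (\<phi> k) l j))\<^sup>2) = 1"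
      by (simp only: of_real_eq_iff)
    moreover have "(cmod (entry (\<phi> b) i j))\<^sup>2 \<le> (\<Sum>l<q. (cmod (entry (\<phi> b) l j))\<^sup>2)"
      using ij by (intro member_le_sum) auto
    moreover have "0 \<le> (\<Sum>l<q. (cmod (entry (\<phi> k) l j))\<^sup>2)" by (simp add: sum_nonneg)
    ultimately have "(cmod (entry (\<phi> b) i j))\<^sup>2 \<le> 1\<^sup>2" by simp
    then show ?thesis by (rule power2_le_imp_le) simp
  qed
  show ?thesis
  proof (cases "nrm A a = 0")
    case True
    then show ?thesis using a by (simp add: nrm_eq_0_iff entry_rep_zero)
  next
    case False
    then have pos: "nrm A a > 0" using nrm_nonneg[OF a] by simp
    have "cmod (entry (\<phi> ((1 / (2 * nrm A a)) \<odot> a)) i j) \<le> 1"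
      using a pos by (intro small) (auto simp: nrm_smult norm_divide norm_mult)
    then show ?thesis
      using a pos by (simp add: entry_rep_scalar norm_divide norm_mult field_simps)
  qed
qed

end

end

section \<open>The clock and shift representations of the sphere relations\<close>

definition shift_index :: "nat \<Rightarrow> nat \<Rightarrow> nat" where
  "shift_index q j = (if Suc j = q then 0 else Suc j)"

definition clock :: "nat \<Rightarrow> complex \<Rightarrow> nat \<Rightarrow> nat \<Rightarrow> complex" where
  "clock q w i j = (if i = j then w ^ i else 0)"

definition shift :: "nat \<Rightarrow> nat \<Rightarrow> nat \<Rightarrow> complex" where
  "shift q i j = (if i = shift_index q j then 1 else 0)"

lemma shift_index_less: "j < q \<Longrightarrow> shift_index q j < q"
  by (auto simp: shift_index_def)

lemma shift_index_eq_iff: "\<lbrakk>i < q; j < q\<rbrakk> \<Longrightarrow> shift_index q i = shift_index q j \<longleftrightarrow> i = j"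
  by (auto simp: shift_index_def)

lemma shift_index_surj: "i < q \<Longrightarrow> \<exists>j<q. i = shift_index q j"
  by (cases i) (auto simp: shift_index_def intro: exI[of _ "q - 1"])

lemma sum_mult_shift:
  "j < q \<Longrightarrow> (\<Sum>k<q. f k * shift q k j) = f (shift_index q j)"
  "j < q \<Longrightarrow> (\<Sum>k<q. shift q k j * f k) = f (shift_index q j)"
  "i < q \<Longrightarrow> (\<Sum>k<q. f k * clock q w k i) = f i * w ^ i"
  "i < q \<Longrightarrow> (\<Sum>k<q. clock q w i k * f k) = w ^ i * f i"
proof -
  show *: "(\<Sum>k<q. f k * shift q k j) = f (shift_index q j)" if "j < q"
    using shift_index_less[OF that] by (simp add: shift_def if_distrib cong: if_cong)
  then show "(\<Sum>k<q. shift q k j * f k) = f (shift_index q j)" if "j < q"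
    using that by (simp add: mult.commute)
  show "(\<Sum>k<q. f k * clock q w k i) = f i * w ^ i" if "i < q"
    using that by (simp add: clock_def if_distrib cong: if_cong)
  have "(\<Sum>k<q. f k * clock q w i k) = f i * w ^ i" if "i < q"
    using that by (simp add: clock_def if_distrib cong: if_cong)
  then show "(\<Sum>k<q. clock q w i k * f k) = w ^ i * f i" if "i < q"
    using that by (simp add: mult.commute)
qed

text \<open>The relation D S = w S D: the shift moves position j to j + 1, where the clock has one
  more factor w. At the wrap-around from q - 1 to 0 this is the equation w^q = 1.\<close>

lemma clock_shift_commute:
  assumes "w ^ q = 1" "i < q" "j < q"
  shows "(\<Sum>k<q. clock q w i k * shift q k j) = w * (\<Sum>k<q. shift q i k * clock q w k j)"
proof -
  have "w ^ shift_index q j = w * w ^ j"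
    using assms(1) by (auto simp: shift_index_def simp flip: power_Suc)
  then show ?thesis
    using assms(2,3) by (simp add: sum_mult_shift) (auto simp: shift_def clock_def)
qed

lemma clock_unitary:
  assumes "cmod w = 1" "i < q" "j < q"
  shows "(\<Sum>k<q. cnj (clock q w k i) * clock q w k j) = (if i = j then 1 else 0)"
    and "(\<Sum>k<q. clock q w i k * cnj (clock q w j k)) = (if i = j then 1 else 0)"
proof -
  have "w ^ i * cnj w ^ i = 1"
    using assms(1) complex_norm_square[of w] by (simp flip: power_mult_distrib)
  then show "(\<Sum>k<q. cnj (clock q w k i) * clock q w k j) = (if i = j then 1 else 0)"
     "(\<Sum>k<q. clock q w i k * cnj (clock q w j k)) = (if i = j then 1 else 0)"
    using assms(2,3) by (simp_all add: sum_mult_shift) (auto simp: clock_def mult.commute)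
qed

lemma shift_unitary:
  assumes "i < q" "j < q"
  shows "(\<Sum>k<q. cnj (shift q k i) * shift q k j) = (if i = j then 1 else 0)"
    and "(\<Sum>k<q. shift q i k * cnj (shift q j k)) = (if i = j then 1 else 0)"
proof -
  show "(\<Sum>k<q. cnj (shift q k i) * shift q k j) = (if i = j then 1 else 0)"
    using assms shift_index_eq_iff[of i q j] by (simp add: sum_mult_shift) (auto simp: shift_def)
  obtain l where l: "l < q" "i = shift_index q l" using shift_index_surj[OF assms(1)] by blast
  have "(\<Sum>k<q. shift q i k * cnj (shift q j k)) = (\<Sum>k<q. if k = l then cnj (shift q j k) else 0)"
    using l shift_index_eq_iff by (intro sum.cong) (auto simp: shift_def)
  also have "\<dots> = cnj (shift q j l)" using l by simp
  finally show "(\<Sum>k<q. shift q i k * cnj (shift q j k)) = (if i = j then 1 else 0)"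
    using l by (auto simp: shift_def)
qed

text \<open>D and S are unitary, so the weights give (1 - r^2) + r^2 = 1 in the sphere equation. At
  r = 0 only the diagonal matrix D remains.\<close>

definition clock_shift_sphere ::
    "nat \<Rightarrow> complex \<Rightarrow> 'n \<Rightarrow> 'n \<Rightarrow> real \<Rightarrow> 'n \<Rightarrow> real \<Rightarrow> complex" where
  "clock_shift_sphere q w a b r l = of_entries q (\<lambda>i j.
     if l = a then sqrt (1 - r\<^sup>2) * clock q w i j else if l = b then r * shift q i j else 0)"

lemma entry_finsum_matrix_cstar:
  assumes "finite F" "f \<in> F \<rightarrow> carrier (matrix_cstar q)" "i < q" "j < q"
  shows "entry (finsum (matrix_cstar q) f F) i j = (\<Sum>x\<in>F. entry (f x) i j)"
proof -
  interpret ring "matrix_cstar q" by (rule ring_matrix_cstar)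
  show ?thesis
    using assms by (induction F rule: finite_induct) (auto simp: finsum_insert)
qed

text \<open>The relation for the index pair (b, a) reads \<open>t\<^sub>a t\<^sub>b = exp (2 pi i
  \<theta>\<^sub>b\<^sub>a) t\<^sub>b t\<^sub>a\<close>, and skew-symmetry turns its phase into w;
  hence the sign in the exponent. Pairs involving any other index hold because both products are
  zero.\<close>

lemma sphere_relations_clock_shift:
  fixes \<theta> :: "real^'n^'n" and a b :: "'n::finite"
  assumes skew: "transpose \<theta> = - \<theta>" and ab: "a \<noteq> b" and r: "0 \<le> r" "r \<le> 1"
    and w: "w = exp (- 2 * of_real pi * \<i> * of_real (\<theta> $ a $ b))" "w ^ q = 1"
  shows "sphere_relations \<theta> (matrix_cstar q) (clock_shift_sphere q w a b r)"
proof -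
  let ?B = "matrix_cstar q" and ?s = "clock_shift_sphere q w a b r"
  have skew': "\<theta> $ j $ k = - \<theta> $ k $ j" for j k
    using arg_cong[OF skew, of "\<lambda>M. M $ k $ j"] by (simp add: transpose_def)
  have wc: "cmod w = 1" by (simp add: w(1) norm_exp_eq_Re)
  have W: "exp (2 * of_real pi * \<i> * of_real (\<theta> $ a $ b)) * w = 1"
    by (simp add: w(1) flip: exp_add)
  have w': "w = exp (2 * of_real pi * \<i> * of_real (\<theta> $ b $ a))"
    using skew'[of b a] by (simp add: w(1))
  have sqrt: "complex_of_real (sqrt (1 - r\<^sup>2)) * complex_of_real (sqrt (1 - r\<^sup>2)) = of_real (1 - r\<^sup>2)"
    using r by (simp add: abs_square_le_1 flip: of_real_mult)
  have adj_mult: "entry (adj ?B (?s l) \<otimes>\<^bsub>?B\<^esub> ?s l) i j =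
      (if l = a then of_real (1 - r\<^sup>2) else if l = b then of_real (r\<^sup>2) else 0) * (if i = j then 1 else 0)"
    if "i < q" "j < q" for i j l
  proof -
    define d :: complex where "d = (if i = j then 1 else 0)"
    have "(\<Sum>k<q. cnj (sqrt (1 - r\<^sup>2) * clock q w k i) * (sqrt (1 - r\<^sup>2) * clock q w k j)) =
        of_real (1 - r\<^sup>2) * (\<Sum>k<q. cnj (clock q w k i) * clock q w k j)"
      unfolding sqrt[symmetric] sum_distrib_left by (intro sum.cong) auto
    moreover have "(\<Sum>k<q. cnj (r * shift q k i) * (r * shift q k j)) =
        of_real (r\<^sup>2) * (\<Sum>k<q. cnj (shift q k i) * shift q k j)"
      unfolding sum_distrib_left by (intro sum.cong) (auto simp: power2_eq_square)
    ultimately show ?thesis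
      unfolding clock_unitary(1)[OF wc that] shift_unitary(1)[OF that] d_def[symmetric] using that ab
      by (simp add: clock_shift_sphere_def del: complex_cnj_mult of_real_diff of_real_power)
  qed
  have mult_adj: "entry (?s l \<otimes>\<^bsub>?B\<^esub> adj ?B (?s l)) i j =
      (if l = a then of_real (1 - r\<^sup>2) else if l = b then of_real (r\<^sup>2) else 0) * (if i = j then 1 else 0)"
    if "i < q" "j < q" for i j l
  proof -
    define d :: complex where "d = (if i = j then 1 else 0)"
    have "(\<Sum>k<q. (sqrt (1 - r\<^sup>2) * clock q w i k) * cnj (sqrt (1 - r\<^sup>2) * clock q w j k)) =
        of_real (1 - r\<^sup>2) * (\<Sum>k<q. clock q w i k * cnj (clock q w j k))"
      unfolding sqrt[symmetric] sum_distrib_left by (intro sum.cong) auto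
    moreover have "(\<Sum>k<q. (r * shift q i k) * cnj (r * shift q j k)) =
        of_real (r\<^sup>2) * (\<Sum>k<q. shift q i k * cnj (shift q j k))"
      unfolding sum_distrib_left by (intro sum.cong) (auto simp: power2_eq_square)
    ultimately show ?thesis
      unfolding clock_unitary(2)[OF wc that] shift_unitary(2)[OF that] d_def[symmetric] using that ab
      by (simp add: clock_shift_sphere_def del: complex_cnj_mult of_real_diff of_real_power)
  qed
  have comm: "?s a \<otimes>\<^bsub>?B\<^esub> ?s b = w \<odot>\<^bsub>?B\<^esub> (?s b \<otimes>\<^bsub>?B\<^esub> ?s a)"
  proof (rule matrix_cstar_eqI[of _ q]; (rule matrix_cstar_ops_closed)?)
    fix i j assume ij: "i < q" "j < q"
    have "(\<Sum>k<q. (sqrt (1 - r\<^sup>2) * clock q w i k) * (r * shift q k j)) =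
        (sqrt (1 - r\<^sup>2) * r) * (\<Sum>k<q. clock q w i k * shift q k j)"
      unfolding sum_distrib_left by (intro sum.cong) auto
    moreover have "(\<Sum>k<q. (r * shift q i k) * (sqrt (1 - r\<^sup>2) * clock q w k j)) =
        (sqrt (1 - r\<^sup>2) * r) * (\<Sum>k<q. shift q i k * clock q w k j)"
      unfolding sum_distrib_left by (intro sum.cong) auto
    ultimately show "entry (?s a \<otimes>\<^bsub>?B\<^esub> ?s b) i j = entry (w \<odot>\<^bsub>?B\<^esub> (?s b \<otimes>\<^bsub>?B\<^esub> ?s a)) i j"
      using ij ab clock_shift_commute[OF w(2) ij] by (simp add: clock_shift_sphere_def)
  qed
  have zero: "?s l \<otimes>\<^bsub>?B\<^esub> ?s m = c \<odot>\<^bsub>?B\<^esub> (?s m \<otimes>\<^bsub>?B\<^esub> ?s l)" if "l \<notin> {a, b} \<or> m \<notin> {a, b}" for l m c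
    by (rule matrix_cstar_eqI[of _ q]; (rule matrix_cstar_ops_closed)?)
      (use that in \<open>auto simp: clock_shift_sphere_def\<close>)
  interpret B: unital_cstar_algebra ?B by (rule unital_cstar_algebra_matrix_cstar)
  show ?thesis
    unfolding sphere_relations_def
  proof (intro conjI allI)
    show s: "?s j \<in> carrier ?B" for j by (simp add: clock_shift_sphere_def)
    show "adj ?B (?s j) \<otimes>\<^bsub>?B\<^esub> ?s j = ?s j \<otimes>\<^bsub>?B\<^esub> adj ?B (?s j)" for j
      by (rule matrix_cstar_eqI[of _ q]; (rule matrix_cstar_ops_closed)?) (simp only: adj_mult mult_adj)
    show "?s k \<otimes>\<^bsub>?B\<^esub> ?s j = exp (2 * of_real pi * \<i> * of_real (\<theta> $ j $ k)) \<odot>\<^bsub>?B\<^esub> (?s j \<otimes>\<^bsub>?B\<^esub> ?s k)" for j k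
    proof -
      consider "j = k" | "j = a" "k = b" | "j = b" "k = a" | "k \<notin> {a, b} \<or> j \<notin> {a, b}" by auto
      then show ?thesis
      proof cases
        case 1
        then show ?thesis using skew'[of k k] s by simp
      next
        case 2
        then show ?thesis using s comm W by simp
      next
        case 3
        then show ?thesis using comm w' by simp
      qed (rule zero)
    qed
    show "(\<Oplus>\<^bsub>?B\<^esub>j\<in>UNIV. adj ?B (?s j) \<otimes>\<^bsub>?B\<^esub> ?s j) = \<one>\<^bsub>?B\<^esub>"
    proof (rule matrix_cstar_eqI[of _ q])
      show "(\<Oplus>\<^bsub>?B\<^esub>j\<in>UNIV. adj ?B (?s j) \<otimes>\<^bsub>?B\<^esub> ?s j) \<in> carrier ?B"
        using s by (intro B.finsum_closed) auto
      fix i j assume ij: "i < q" "j < q"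
      have "entry (\<Oplus>\<^bsub>?B\<^esub>j\<in>UNIV. adj ?B (?s j) \<otimes>\<^bsub>?B\<^esub> ?s j) i j =
          (\<Sum>l\<in>UNIV. entry (adj ?B (?s l) \<otimes>\<^bsub>?B\<^esub> ?s l) i j)"
        using s ij by (intro entry_finsum_matrix_cstar) auto
      also have "\<dots> = (\<Sum>l\<in>UNIV. (if l = a then of_real (1 - r\<^sup>2) else 0) +
          (if l = b then of_real (r\<^sup>2) else 0)) * (if i = j then 1 else 0)"
        unfolding sum_distrib_right adj_mult[OF ij] using ab by (intro sum.cong) simp_all
      also have "\<dots> = (if i = j then 1 else 0)"
        unfolding sum.distrib by simp
      finally show "entry (\<Oplus>\<^bsub>?B\<^esub>j\<in>UNIV. adj ?B (?s j) \<otimes>\<^bsub>?B\<^esub> ?s j) i j = entry \<one>\<^bsub>?B\<^esub> i j"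
        using ij by simp
    qed simp
  qed
qed

section \<open>Failure of algebraic finite generation\<close>

text \<open>Passing to exp (n y) makes the bound depend on the product n y alone, so that the
  majorant in \<open>nrm_one_plus_pow_linear\<close> is controlled for arbitrarily large n.\<close>

lemma power_linear_remainder_le:
  fixes y :: real
  assumes "0 \<le> y" "n * y \<le> 1"
  shows "(1 + y) ^ n - 1 - n * y \<le> (n * y)\<^sup>2"
proof -
  have "(1 + y) ^ n \<le> exp y ^ n"
    using assms by (intro power_mono) (auto simp: add.commute)
  also have "\<dots> = exp (n * y)" by (simp flip: exp_of_nat_mult)
  also have "\<dots> \<le> 1 + n * y + (n * y)\<^sup>2" using assms by (intro exp_bound) auto
  finally show ?thesis by simp
qed

context unital_cstar_algebra
begin

text \<open>Banach-Steinhaus for the functionals f n / g n, written without division so that g n may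
  vanish. The bound K supplies the continuity that makes the sets F N closed.\<close>

lemma uniform_boundedness:
  fixes f :: "nat \<Rightarrow> 'a \<Rightarrow> complex" and g :: "nat \<Rightarrow> real"
  assumes f_add: "\<And>n x y. \<lbrakk>x \<in> carrier A; y \<in> carrier A\<rbrakk> \<Longrightarrow> f n (x \<oplus> y) = f n x + f n y"
    and f_scalar: "\<And>n c x. x \<in> carrier A \<Longrightarrow> f n (c \<odot> x) = c * f n x"
    and f_bound: "\<And>n x. x \<in> carrier A \<Longrightarrow> cmod (f n x) \<le> K * nrm A x"
    and g: "\<And>n. g n \<ge> 0"
    and pointwise: "\<And>x. x \<in> carrier A \<Longrightarrow> \<exists>C. \<forall>n. cmod (f n x) \<le> C * g n"
  obtains C where "\<And>n x. \<lbrakk>x \<in> carrier A; nrm A x \<le> 1\<rbrakk> \<Longrightarrow> cmod (f n x) \<le> C * g n"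
proof -
  define F where "F N = {x \<in> carrier A. \<forall>n. cmod (f n x) \<le> real N * g n}" for N
  have closed: "closedin mtopology (F N)" for N
    unfolding closedin_iff
  proof (intro conjI ballI impI)
    fix x assume x: "x \<in> carrier A" and approx: "\<forall>e>0. \<exists>y\<in>F N. nrm A (x \<ominus> y) < e"
    have "cmod (f n x) \<le> real N * g n + e" if "e > 0" for n e
    proof -
      have "e / (\<bar>K\<bar> + 1) > 0" using that by simp
      then obtain y where y: "y \<in> F N" "nrm A (x \<ominus> y) < e / (\<bar>K\<bar> + 1)"
        using approx by blast
      have yc: "y \<in> carrier A" using y by (simp add: F_def)
      have "f n x = f n (x \<ominus> y) + f n y"
        using x yc f_add[of "x \<ominus> y" y n] by (simp add: minus_add_cancel)
      then have "cmod (f n x) \<le> cmod (f n (x \<ominus> y)) + cmod (f n y)"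
        using norm_triangle_ineq by simp
      also have "cmod (f n (x \<ominus> y)) \<le> (\<bar>K\<bar> + 1) * nrm A (x \<ominus> y)"
        by (rule order_trans[OF f_bound mult_right_mono]) (use x yc nrm_nonneg in auto)
      also have "(\<bar>K\<bar> + 1) * nrm A (x \<ominus> y) \<le> e"
        using y(2) by (simp add: pos_less_divide_eq mult.commute)
      also have "cmod (f n y) \<le> real N * g n" using y by (simp add: F_def)
      finally show ?thesis by simp
    qed
    then show "x \<in> F N"
      using x by (auto simp: F_def intro: field_le_epsilon)
  qed (auto simp: F_def)
  have "\<Union>(range F) = carrier A"
  proof
    show "carrier A \<subseteq> \<Union>(range F)"
    proof
      fix x assume x: "x \<in> carrier A"
      then obtain C where C: "\<And>n. cmod (f n x) \<le> C * g n" using pointwise by blast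
      obtain N :: nat where "C \<le> real N" using real_arch_simple by blast
      then have "cmod (f n x) \<le> real N * g n" for n
        using C[of n] mult_right_mono[of C "real N" "g n"] g by (meson order_trans)
      then show "x \<in> \<Union>(range F)" using x by (auto simp: F_def)
    qed
  qed (auto simp: F_def)
  moreover have "mtopology interior_of carrier A = carrier A"
    using interior_of_topspace[of mtopology] by simp
  ultimately have "mtopology interior_of \<Union>(range F) \<noteq> {}"
    using zero_closed by auto
  then obtain N where "mtopology interior_of F N \<noteq> {}"
    using metric_Baire_category_alt[OF complete, of "range F"] closed by auto
  then obtain x e where x: "x \<in> carrier A" and e: "e > 0" "mball x e \<subseteq> F N"
    by (auto simp: metric_interior_of)
  show thesis
  proof (rule that[of "2 / e * (2 * real N)"])
    fix n a assume a: "a \<in> carrier A" "nrm A a \<le> 1"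
    \<comment> \<open>Both x and x + b lie in the ball inside F N. Subtracting them costs the factor
      2, and rescaling b to a costs 2 / e.\<close>
    define b where "b = (e/2) \<odot> a"
    have b: "b \<in> carrier A" "nrm A b < e"
      using a e mult_left_mono[OF a(2), of "e/2"] by (auto simp: b_def nrm_smult norm_divide)
    have "x \<ominus> (x \<oplus> b) = \<ominus> b"
      using x b by (simp add: a_minus_def minus_add r_neg2)
    then have "x \<oplus> b \<in> mball x e" "x \<in> mball x e"
      using x b e by (auto simp: nrm_dist_def nrm_uminus simp del: centre_in_mball_iff) (simp add: a_minus_def r_neg)
    then have "cmod (f n (x \<oplus> b)) \<le> real N * g n" "cmod (f n x) \<le> real N * g n"
      using e(2) by (auto simp: F_def)
    moreover have "f n b = f n (x \<oplus> b) - f n x"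
      using x b by (simp add: f_add)
    ultimately have "cmod (f n b) \<le> 2 * real N * g n"
      using norm_triangle_ineq4[of "f n (x \<oplus> b)" "f n x"] by simp
    moreover have "f n a = (2/e) * f n b"
      using a e by (simp add: b_def f_scalar)
    then have "cmod (f n a) = 2/e * cmod (f n b)"
      using e by (simp add: norm_mult norm_divide)
    ultimately show "cmod (f n a) \<le> 2 / e * (2 * real N) * g n"
      using mult_left_mono[of "cmod (f n b)" "2 * real N * g n" "2/e"] e by (simp add: mult.assoc)
  qed
qed

text \<open>A substitute for the unitary exp (i u x). With K = |u| ||x||, each factor has squared
  norm at most 1 + (K/m)^2, so the squared norm of the power is at most exp (K^2 / m), which is
  below 4 once m exceeds K^2. The bound 2 is thus uniform in u, while m depends on u.\<close>

lemma bounded_unitary_power: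
  assumes x: "x \<in> carrier A" "adj A x = x"
  obtains m :: nat where "m > 0" "nrm A ((\<one> \<oplus> (\<i> * of_real u / of_nat m) \<odot> x) [^] m) \<le> 2"
proof -
  define K where "K = \<bar>u\<bar> * nrm A x"
  obtain m :: nat where m: "real m \<ge> K\<^sup>2 + 1"
    using real_arch_simple by blast
  then have m0: "m > 0" using zero_le_power2[of K] by (cases "m = 0") auto
  define c where "c = K / m"
  define k where "k = (\<i> * of_real u / of_nat m) \<odot> x"
  have k: "k \<in> carrier A" "adj A k = \<ominus> k" "nrm A k \<le> c"
    using x by (simp_all add: k_def c_def K_def adj_smult minus_scalar nrm_smult norm_mult norm_divide)
  have "(nrm A ((\<one> \<oplus> k) [^] m))\<^sup>2 \<le> (nrm A (\<one> \<oplus> k) ^ m)\<^sup>2"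
    using k by (intro power_mono nrm_pow_le nrm_nonneg) auto
  also have "\<dots> = ((nrm A (\<one> \<oplus> k))\<^sup>2) ^ m"
    by (simp add: mult.commute flip: power_mult)
  also have "\<dots> \<le> (1 + c\<^sup>2) ^ m"
    using nrm_one_plus_skew[OF k] by (intro power_mono) auto
  also have "\<dots> \<le> exp (c\<^sup>2) ^ m"
    by (intro power_mono) (auto simp: add.commute)
  also have "\<dots> = exp (K\<^sup>2 / m)"
    using m0 by (simp add: c_def power2_eq_square flip: exp_of_nat_mult)
  also have "\<dots> \<le> exp 1"
    using m m0 by (simp add: field_simps)
  also have "\<dots> \<le> 2\<^sup>2"
    using exp_le by simp
  finally have "nrm A ((\<one> \<oplus> k) [^] m) \<le> 2"
    by (rule power2_le_imp_le) simp
  then show thesis using that m0 by (simp add: k_def)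
qed

text \<open>In the (i, j) entry of a product, each summand has a factor with i distinct from k or
  one with k distinct from j. That factor tends to zero and the other is bounded uniformly in n. The
  same uniform bound carries the limit from words to their closure.\<close>

lemma off_diagonal_tendsto_0:
  assumes gen: "cstar_generated_by A G0" "G0 \<subseteq> G" and G: "G \<subseteq> carrier A" "adj A ` G \<subseteq> G"
    and rep: "\<And>n. matrix_representation A q (\<Phi> n)"
    and lim: "\<And>g i j. \<lbrakk>g \<in> G; i < q; j < q; i \<noteq> j\<rbrakk> \<Longrightarrow> (\<lambda>n. entry (\<Phi> n g) i j) \<longlonglongrightarrow> 0"
    and a: "a \<in> carrier A" and ij: "i < q" "j < q" "i \<noteq> j"
  shows "(\<lambda>n. entry (\<Phi> n a) i j) \<longlonglongrightarrow> 0"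
proof -
  note bound = matrix_representation.cmod_entry_rep_le[OF rep]
  note closed = words_span_closed[OF G(1)]
  have W: "(\<lambda>n. entry (\<Phi> n x) i j) \<longlonglongrightarrow> 0" if "x \<in> words_span A G" "i < q" "j < q" "i \<noteq> j" for x i j
    using that
  proof (induction arbitrary: i j)
    case one
    then show ?case by (simp add: matrix_representation.entry_rep_one[OF rep])
  next
    case (add x y)
    then show ?case
      using tendsto_add[OF add.IH] closed by (simp add: matrix_representation.entry_rep_add[OF rep])
  next
    case (scalar x c)
    then show ?case
      using tendsto_mult[OF tendsto_const[of c] scalar.IH] closed
      by (simp add: matrix_representation.entry_rep_scalar[OF rep])
  next
    case (mult g x)
    have c: "g \<in> carrier A" "x \<in> carrier A" using mult closed G by auto
    have "(\<lambda>n. entry (\<Phi> n g) i k * entry (\<Phi> n x) k j) \<longlonglongrightarrow> 0" if k: "k < q" for k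
    proof (cases "i = k")
      case False
      show ?thesis
      proof (rule tendsto_0_le[OF lim[OF mult(1) mult.prems(1) k False]])
        show "\<forall>\<^sub>F n in sequentially. norm (entry (\<Phi> n g) i k * entry (\<Phi> n x) k j)
            \<le> norm (entry (\<Phi> n g) i k) * (2 * nrm A x)"
          using bound[OF k mult.prems(2) c(2)] by (auto simp: norm_mult intro!: always_eventually mult_left_mono)
      qed
    next
      case True
      then have "(\<lambda>n. entry (\<Phi> n x) k j) \<longlonglongrightarrow> 0"
        using mult by simp
      then show ?thesis
      proof (rule tendsto_0_le)
        show "\<forall>\<^sub>F n in sequentially. norm (entry (\<Phi> n g) i k * entry (\<Phi> n x) k j)
            \<le> norm (entry (\<Phi> n x) k j) * (2 * nrm A g)"
          using bound[OF mult.prems(1) k c(1)]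
          by (auto simp: norm_mult mult.commute intro!: always_eventually mult_right_mono)
      qed
    qed
    then have "(\<lambda>n. \<Sum>k<q. entry (\<Phi> n g) i k * entry (\<Phi> n x) k j) \<longlonglongrightarrow> 0"
      by (intro tendsto_null_sum) auto
    then show ?case
      using c mult.prems by (simp add: matrix_representation.entry_rep_mult[OF rep])
  qed
  show ?thesis
  proof (rule LIMSEQ_I)
    fix e :: real assume e: "e > 0"
    \<comment> \<open>The entry bound has the constant 2, so e / 4 contributes e / 2.\<close>
    obtain y where y: "y \<in> words_span A G" "y \<in> carrier A" "nrm A (a \<ominus> y) < e / 4"
      using generated_approx[OF gen G a, of "e / 4"] e by auto
    obtain N where N: "\<And>n. n \<ge> N \<Longrightarrow> norm (entry (\<Phi> n y) i j) < e / 2"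
      using LIMSEQ_D[OF W[OF y(1) ij], of "e / 2"] e by auto
    have "norm (entry (\<Phi> n a) i j) < e" if "n \<ge> N" for n
    proof -
      have "entry (\<Phi> n a) i j = entry (\<Phi> n (a \<ominus> y)) i j + entry (\<Phi> n y) i j"
        using a y ij by (simp add: matrix_representation.entry_rep_minus[OF rep])
      then have "norm (entry (\<Phi> n a) i j) \<le> norm (entry (\<Phi> n (a \<ominus> y)) i j) + norm (entry (\<Phi> n y) i j)"
        using norm_triangle_ineq by simp
      then show ?thesis
        using bound[OF ij(1,2), of "a \<ominus> y" n] N[OF that] a y by simp
    qed
    then show "\<exists>N. \<forall>n\<ge>N. norm (entry (\<Phi> n a) i j - 0) < e" by auto
  qed
qed

text \<open>In the (1, 0) entry of z s the summand k = 0 carries the factor z_10 = 0, and the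
  remaining ones carry entries of s below the diagonal in column 0. The constant depends on x
  through the norms of the coefficients; the sequence of sums depends on S only.\<close>

lemma corner_bound:
  assumes S: "finite S" "S \<subseteq> carrier A" and rep: "\<And>n. matrix_representation A q (\<Phi> n)" and q: "q \<ge> 2"
    and center: "\<And>z n. z \<in> cstar_center A \<Longrightarrow> entry (\<Phi> n z) 1 0 = 0"
    and x: "x \<in> center_span S"
  shows "\<exists>C. \<forall>n. cmod (entry (\<Phi> n x) 1 0) \<le> C * (\<Sum>s\<in>S. \<Sum>k=1..<q. cmod (entry (\<Phi> n s) k 0))"
  using S x
proof (induction rule: center_span_induct)
  case zero
  show ?case
    using q by (intro exI[of _ 0]) (simp add: matrix_representation.entry_rep_zero[OF rep])
next
  case (add x y)
  let ?g = "\<lambda>n. \<Sum>s\<in>S. \<Sum>k=1..<q. cmod (entry (\<Phi> n s) k 0)"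
  from add obtain C C' where C: "\<And>n. cmod (entry (\<Phi> n x) 1 0) \<le> C * ?g n"
    and C': "\<And>n. cmod (entry (\<Phi> n y) 1 0) \<le> C' * ?g n"
    by blast
  have "cmod (entry (\<Phi> n (x \<oplus> y)) 1 0) \<le> (C + C') * ?g n" for n
    using C[of n] C'[of n] norm_triangle_ineq[of "entry (\<Phi> n x) 1 0" "entry (\<Phi> n y) 1 0"] q add
    by (simp add: matrix_representation.entry_rep_add[OF rep] distrib_right)
  then show ?case by blast
next
  case (generator z s)
  have c: "z \<in> carrier A" "s \<in> carrier A" using generator S center_closed by auto
  have "cmod (entry (\<Phi> n (z \<otimes> s)) 1 0) \<le> (2 * nrm A z) * (\<Sum>s\<in>S. \<Sum>k=1..<q. cmod (entry (\<Phi> n s) k 0))" for n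
  proof -
    have split: "{..<q} = insert 0 {1..<q}" using q by auto
    have "entry (\<Phi> n (z \<otimes> s)) 1 0 = (\<Sum>k<q. entry (\<Phi> n z) 1 k * entry (\<Phi> n s) k 0)"
      using c q by (simp add: matrix_representation.entry_rep_mult[OF rep])
    also have "\<dots> = (\<Sum>k=1..<q. entry (\<Phi> n z) 1 k * entry (\<Phi> n s) k 0)"
      unfolding split using center[OF generator(1)] by simp
    also have "cmod \<dots> \<le> (\<Sum>k=1..<q. 2 * nrm A z * cmod (entry (\<Phi> n s) k 0))"
      using q c by (intro order_trans[OF norm_sum] sum_mono)
        (auto simp: norm_mult intro!: mult_right_mono matrix_representation.cmod_entry_rep_le[OF rep])
    also have "\<dots> = 2 * nrm A z * (\<Sum>k=1..<q. cmod (entry (\<Phi> n s) k 0))"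
      by (simp add: sum_distrib_left)
    also have "\<dots> \<le> 2 * nrm A z * (\<Sum>s\<in>S. \<Sum>k=1..<q. cmod (entry (\<Phi> n s) k 0))"
      using generator(2) S(1) nrm_nonneg[OF c(1)]
      by (intro mult_left_mono member_le_sum[of s S "\<lambda>s. \<Sum>k=1..<q. cmod (entry (\<Phi> n s) k 0)"])
        (auto intro!: sum_nonneg)
    finally show ?thesis .
  qed
  then show ?case by blast
qed

end

lemma nrm_shift_le_one: "nrm (matrix_cstar q) (of_entries q (shift q)) \<le> 1"
proof -
  let ?B = "matrix_cstar q" and ?S = "of_entries q (shift q)"
  interpret B: unital_cstar_algebra ?B by (rule unital_cstar_algebra_matrix_cstar)
  have "adj ?B ?S \<otimes>\<^bsub>?B\<^esub> ?S = \<one>\<^bsub>?B\<^esub>"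
    by (rule matrix_cstar_eqI[of _ q]; (rule matrix_cstar_ops_closed)?) (simp add: shift_unitary)
  then have "(nrm ?B ?S)\<^sup>2 \<le> 1\<^sup>2"
    using B.nrm_cstar[of ?S] B.nrm_one_le by simp
  then show ?thesis by (rule power2_le_imp_le) simp
qed

text \<open>With \<open>r = 1 / (8 u)\<close> the image of the power is close to \<open>exp (\<i> (S + S*) / 8)\<close>, where \<open>S\<close> is the
  shift, while \<open>bounded_unitary_power\<close> keeps its norm below \<open>2\<close> for every \<open>u\<close>.\<close>

lemma (in matrix_representation) cmod_corner_unitary_power_ge:
  assumes q: "q \<ge> 2" and s: "s \<in> carrier A" and m: "m > 0"
    and \<phi>: "\<phi> s = of_entries q (\<lambda>i j. of_real (1 / (8 * u)) * shift q i j)" and u: "u > 0"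
  shows "cmod (entry (\<phi> ((\<one> \<oplus> (\<i> * of_real u / of_nat m) \<odot> (s \<oplus> adj A s)) [^] m)) 1 0) \<ge> 1/16"
proof -
  let ?B = "matrix_cstar q" and ?S = "of_entries q (shift q)"
  interpret B: unital_cstar_algebra ?B by (rule unital_cstar_algebra_matrix_cstar)
  define c where "c = \<i> * of_real u / of_nat m"
  define V where "V = \<phi> (s \<oplus> adj A s)"
  define Y where "Y = c \<odot>\<^bsub>?B\<^esub> V"
  have V: "V \<in> carrier ?B" and Y: "Y \<in> carrier ?B"
    using s by (auto simp: V_def Y_def rep_closed)
  have "\<phi> s = complex_of_real (1 / (8 * u)) \<odot>\<^bsub>?B\<^esub> ?S"
    unfolding \<phi> by (rule matrix_cstar_eqI[of _ q]) (auto simp: matrix_cstar_ops_closed)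
  then have "nrm ?B (\<phi> s) \<le> 1 / (8 * u)"
    using nrm_shift_le_one[of q] u by (simp add: B.nrm_smult norm_divide norm_mult divide_le_cancel)
  then have "nrm ?B V \<le> 1 / (4 * u)"
    using B.nrm_triangle[of "\<phi> s" "adj ?B (\<phi> s)"] rep_closed[OF s] s by (simp add: V_def rep_add rep_adj)
  then have "u * nrm ?B V \<le> 1/4"
    using u by (simp add: field_simps)
  moreover have mY: "real m * nrm ?B Y = u * nrm ?B V"
    using V m u by (simp add: Y_def c_def B.nrm_smult norm_divide norm_mult)
  ultimately have small: "real m * nrm ?B Y \<le> 1/4" by simp
  have "entry V 1 0 = of_real (1 / (8 * u)) * (shift q 1 0 + cnj (shift q 0 1))"
    using q s unfolding V_def by (simp add: rep_add rep_adj) (simp add: \<phi> distrib_left add_divide_distrib)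
  \<comment> \<open>For q = 2 the shift is its own adjoint and both summands contribute.\<close>
  also have "shift q 1 0 + cnj (shift q 0 1) = of_real (if q = 2 then 2 else 1)"
    using q by (auto simp: shift_def shift_index_def)
  finally have V10: "entry V 1 0 = of_real ((if q = 2 then 2 else 1) / (8 * u))" by simp
  define L where "L = \<one>\<^bsub>?B\<^esub> \<oplus>\<^bsub>?B\<^esub> of_nat m \<odot>\<^bsub>?B\<^esub> Y"
  define P where "P = (\<one>\<^bsub>?B\<^esub> \<oplus>\<^bsub>?B\<^esub> Y) [^]\<^bsub>?B\<^esub> m"
  have LP: "L \<in> carrier ?B" "P \<in> carrier ?B" using Y by (auto simp: L_def P_def)
  have "entry L 1 0 = \<i> * of_real u * entry V 1 0"
    using q m by (simp add: L_def Y_def c_def)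
  then have "cmod (entry L 1 0) = u * cmod (entry V 1 0)"
    using u by (simp only: norm_mult norm_ii norm_of_real abs_of_pos mult_1)
  moreover have "cmod (entry V 1 0) \<ge> 1 / (8 * u)"
    unfolding V10 norm_of_real using u by (auto simp: field_simps)
  ultimately have L10: "cmod (entry L 1 0) \<ge> 1/8"
    using u mult_left_mono[of "1 / (8 * u)" "cmod (entry V 1 0)" u] by simp
  \<comment> \<open>The linear part contributes at least 1/8 to the corner entry, and the remainder
    at most (1/4)^2 = 1/16, which leaves 1/16.\<close>
  have "nrm ?B (P \<ominus>\<^bsub>?B\<^esub> L) \<le> (real m * nrm ?B Y)\<^sup>2"
    unfolding P_def L_def using B.nrm_one_plus_pow_linear[OF Y, of m] B.nrm_nonneg[OF Y] small
      power_linear_remainder_le[of "nrm ?B Y" m] by linarith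
  also have "\<dots> \<le> (1/4)\<^sup>2"
    using small B.nrm_nonneg[OF Y] by (intro power_mono) auto
  finally have "nrm ?B (P \<ominus>\<^bsub>?B\<^esub> L) \<le> 1/16" by (simp add: power2_eq_square)
  then have "cmod (entry P 1 0 - entry L 1 0) \<le> 1/16"
    using cmod_entry_le_op_norm[of 1 q 0 "entry (P \<ominus>\<^bsub>?B\<^esub> L)"] q LP
    by (simp add: nrm_matrix_cstar entry_minus_matrix_cstar)
  then have "cmod (entry P 1 0) \<ge> 1/16"
    using L10 norm_triangle_ineq3[of "entry P 1 0" "entry L 1 0"] by linarith
  moreover have "\<phi> ((\<one> \<oplus> c \<odot> (s \<oplus> adj A s)) [^] m) = P"
    using s by (simp add: rep_pow rep_add rep_one rep_scalar P_def Y_def V_def rep_adj)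
  ultimately show ?thesis by (simp add: c_def)
qed

text \<open>Comparing the (1, 0) entries of z t and t z gives d z_10 = w d z_10: the clock has the
  eigenvalues 1 and w at the positions 0 and 1.\<close>

lemma entry_center_corner:
  assumes "matrix_representation A q \<phi>" and z: "z \<in> cstar_center A" and t: "t \<in> carrier A"
    and q: "q \<ge> 2" and w: "w \<noteq> 1" and d: "d \<noteq> 0"
    and \<phi>: "\<phi> t = of_entries q (\<lambda>i j. d * clock q w i j)"
  shows "entry (\<phi> z) 1 0 = 0"
proof -
  interpret matrix_representation A q \<phi> by fact
  have zc: "z \<in> carrier A" using z by (rule center_closed)
  have "entry (\<phi> (z \<otimes>\<^bsub>A\<^esub> t)) 1 0 = (\<Sum>k<q. (d * entry (\<phi> z) 1 k) * clock q w k 0)"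
    using q by (subst entry_rep_mult) (auto simp: zc t \<phi> intro!: sum.cong)
  also have "\<dots> = d * entry (\<phi> z) 1 0"
    using q by (simp add: sum_mult_shift)
  finally have 1: "entry (\<phi> (z \<otimes>\<^bsub>A\<^esub> t)) 1 0 = d * entry (\<phi> z) 1 0" .
  have "entry (\<phi> (t \<otimes>\<^bsub>A\<^esub> z)) 1 0 = (\<Sum>k<q. clock q w 1 k * (d * entry (\<phi> z) k 0))"
    using q by (subst entry_rep_mult) (auto simp: zc t \<phi> intro!: sum.cong)
  also have "\<dots> = w * d * entry (\<phi> z) 1 0"
    using q by (simp add: sum_mult_shift)
  finally have "d * entry (\<phi> z) 1 0 = w * d * entry (\<phi> z) 1 0"
    using 1 center_comm[OF z t] by simp
  then show ?thesis using w d by simp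
qed

lemma exp_two_pi_i_neq_one:
  assumes "x \<notin> \<int>"
  shows "exp (- 2 * of_real pi * \<i> * complex_of_real x) \<noteq> 1"
proof
  assume "exp (- 2 * of_real pi * \<i> * complex_of_real x) = 1"
  then have "\<exists>n::int. Im (- 2 * of_real pi * \<i> * complex_of_real x) = of_int (2 * n) * pi"
    by (simp only: exp_eq_1)
  then have "\<exists>n::int. - 2 * pi * x = of_int (2 * n) * pi" by simp
  then obtain n :: int where "- 2 * pi * x = of_int (2 * n) * pi" by (rule exE)
  then have "pi * (x + of_int n) = 0" by (simp add: distrib_left)
  then have "x = of_int (- n)" by simp
  then show False using assms by (metis Ints_of_int)
qed

lemma exp_two_pi_i_power_eq_one:
  assumes "of_nat q * x \<in> \<int>"
  shows "exp (- 2 * of_real pi * \<i> * complex_of_real x) ^ q = 1"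
proof -
  obtain n :: int where "of_nat q * x = of_int n" using assms by (rule Ints_cases)
  then have n: "complex_of_nat q * of_real x = of_int n"
    by (metis of_real_mult of_real_of_int_eq of_real_of_nat_eq)
  have "exp (- 2 * of_real pi * \<i> * complex_of_real x) ^ q =
      exp (- 2 * of_real pi * \<i> * (of_nat q * complex_of_real x))"
    by (simp add: mult_ac flip: exp_of_nat_mult)
  also have "\<dots> = 1"
    unfolding n by (auto simp: exp_eq_1 intro!: exI[of _ "- n"])
  finally show ?thesis .
qed

theorem not_fin_gen_if_not_integral:
  fixes \<theta> :: "real^'n^'n" and A :: "'a cstar" and t :: "'n::finite \<Rightarrow> 'a"
  assumes skew: "transpose \<theta> = - \<theta>" and rat: "\<forall>i j. \<theta> $ i $ j \<in> \<rat>"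
    and univ: "universal_sphere_algebra \<theta> A t" and nonint: "\<theta> $ a $ b \<notin> \<int>"
  shows "\<not> fin_gen_module (center_ring A) (center_module A)"
proof
  interpret unital_cstar_algebra A using univ by (simp add: universal_sphere_algebra_def)
  have t: "t l \<in> carrier A" for l
    using univ by (simp add: universal_sphere_algebra_def sphere_relations_def)
  define G where "G = range t \<union> adj A ` range t"
  have gen: "cstar_generated_by A (range t)" "range t \<subseteq> G" "G \<subseteq> carrier A" "adj A ` G \<subseteq> G"
    using univ t by (auto simp: universal_sphere_algebra_def G_def)
  have ab: "a \<noteq> b"
  proof
    assume "a = b"
    moreover have "\<theta> $ b $ b = - \<theta> $ b $ b"
      using arg_cong[OF skew, of "\<lambda>M. M $ b $ b"] by (simp add: transpose_def)
    ultimately show False using nonint by simp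
  qed
  obtain q :: nat where q0: "q > 0" and q: "\<And>i j. of_nat q * \<theta> $ i $ j \<in> \<int>"
    using common_denominator[OF rat] by blast
  \<comment> \<open>A common denominator 1 would make the chosen entry integral. The bound ensures
    that the position (1, 0) exists.\<close>
  have q2: "q \<ge> 2"
    using q0 q[of a b] nonint by (cases "q = 1") auto
  \<comment> \<open>The order of w may be a proper divisor of q: w^q = 1 makes the cyclic shift
    consistent, and w distinct from 1 separates the positions 0 and 1.\<close>
  define w where "w = exp (- 2 * of_real pi * \<i> * of_real (\<theta> $ a $ b))"
  have w1: "w \<noteq> 1"
    unfolding w_def using nonint by (rule exp_two_pi_i_neq_one)
  have wq: "w ^ q = 1"
    unfolding w_def using q by (rule exp_two_pi_i_power_eq_one)
  \<comment> \<open>This is 1 / (8 u) for u = n + 1. It stays below 1, which keeps the weight of the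
    clock nonzero.\<close>
  define r where "r n = 1 / (8 * (real n + 1))" for n
  have r: "0 \<le> r n" "r n \<le> 1" "r n < 1" "(r n)\<^sup>2 < 1" for n
  proof -
    show *: "0 \<le> r n" "r n < 1" by (auto simp: r_def field_simps)
    then show "r n \<le> 1" by simp
    show "(r n)\<^sup>2 < 1" using * by (simp add: abs_square_less_1)
  qed
  have "\<exists>\<phi>\<in>unital_star_hom A (matrix_cstar q). \<forall>l. \<phi> (t l) = clock_shift_sphere q w a b (r n) l" for n
    using univ sphere_relations_clock_shift[OF skew ab r(1,2) w_def wq]
      unital_cstar_algebra_matrix_cstar[of q] unfolding universal_sphere_algebra_def by blast
  then obtain \<Phi> where \<Phi>: "\<And>n. \<Phi> n \<in> unital_star_hom A (matrix_cstar q)"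
    and \<Phi>_t: "\<And>n l. \<Phi> n (t l) = clock_shift_sphere q w a b (r n) l"
    by metis
  have rep: "matrix_representation A q (\<Phi> n)" for n
    by (intro matrix_representation.intro matrix_representation_axioms.intro \<Phi> unital_cstar_algebra_axioms)
  have "r = (\<lambda>n. inverse (real (Suc n)) * (1 / 8))"
    by (auto simp: r_def divide_simps)
  then have r_lim: "r \<longlonglongrightarrow> 0"
    using tendsto_mult_left_zero[OF LIMSEQ_inverse_real_of_nat, of "1 / 8"] by (simp only:)
  have gens: "(\<lambda>n. entry (\<Phi> n g) i j) \<longlonglongrightarrow> 0" if "g \<in> G" "i < q" "j < q" "i \<noteq> j" for g i j
  proof -
    have *: "(\<lambda>n. entry (\<Phi> n (t l)) i j) \<longlonglongrightarrow> 0" if "i < q" "j < q" "i \<noteq> j" for l i j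
    proof -
      have "(\<lambda>n. complex_of_real (r n) * shift q i j) \<longlonglongrightarrow> 0"
        using tendsto_mult_right[OF tendsto_of_real[OF r_lim], of "shift q i j"] by simp
      then show ?thesis
        using that by (cases "l = a"; cases "l = b") (simp_all add: \<Phi>_t clock_shift_sphere_def clock_def)
    qed
    then have "(\<lambda>n. entry (\<Phi> n (adj A (t l))) i j) \<longlonglongrightarrow> 0" for l
      using tendsto_cnj[OF *[of j i l]] that t by (simp add: matrix_representation.entry_rep_adj[OF rep])
    with * that show ?thesis by (auto simp: G_def)
  qed
  have center: "entry (\<Phi> n z) 1 0 = 0" if "z \<in> cstar_center A" for z n
  proof (rule entry_center_corner[OF rep that t[of a] q2 w1])
    show "\<Phi> n (t a) = of_entries q (\<lambda>i j. of_real (sqrt (1 - (r n)\<^sup>2)) * clock q w i j)"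
      by (simp add: \<Phi>_t clock_shift_sphere_def)
    show "complex_of_real (sqrt (1 - (r n)\<^sup>2)) \<noteq> 0"
      using r(4)[of n] by simp
  qed
  assume "fin_gen_module (center_ring A) (center_module A)"
  then obtain S where S: "finite S" "S \<subseteq> carrier A" "center_span S = carrier A"
    by (auto simp: fin_gen_module_center_iff)
  define g where "g n = (\<Sum>s\<in>S. \<Sum>k=1..<q. cmod (entry (\<Phi> n s) k 0))" for n
  have g0: "g n \<ge> 0" for n by (simp add: g_def sum_nonneg)
  have "g \<longlonglongrightarrow> 0"
    unfolding g_def using S q0
    by (intro tendsto_null_sum tendsto_norm_zero off_diagonal_tendsto_0[OF gen rep gens]) auto
  obtain C where C: "\<And>n x. \<lbrakk>x \<in> carrier A; nrm A x \<le> 1\<rbrakk> \<Longrightarrow> cmod (entry (\<Phi> n x) 1 0) \<le> C * g n"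
  proof (rule uniform_boundedness[of "\<lambda>n x. entry (\<Phi> n x) 1 0" 2 g])
    show "\<exists>C. \<forall>n. cmod (entry (\<Phi> n x) 1 0) \<le> C * g n" if "x \<in> carrier A" for x
      unfolding g_def using corner_bound[OF S(1,2) rep q2 center] that S(3) by simp
  qed (use q2 g0 in \<open>auto simp: matrix_representation.entry_rep_add[OF rep]
      matrix_representation.entry_rep_scalar[OF rep] matrix_representation.cmod_entry_rep_le[OF rep]\<close>)
  define x where "x = t b \<oplus>\<^bsub>A\<^esub> adj A (t b)"
  have x: "x \<in> carrier A" "adj A x = x"
    using t by (auto simp: x_def adj_add a_comm)
  \<comment> \<open>The power has norm at most 2; halving it to reach the unit ball halves the lower
    bound 1/16 as well.\<close>
  have "1/32 \<le> C * g n" for n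
  proof -
    obtain m :: nat where m: "m > 0"
        "nrm A ((\<one>\<^bsub>A\<^esub> \<oplus>\<^bsub>A\<^esub> (\<i> * of_real (real n + 1) / of_nat m) \<odot>\<^bsub>A\<^esub> x) [^]\<^bsub>A\<^esub> m) \<le> 2"
      using bounded_unitary_power[OF x] by blast
    define y where "y = (\<one>\<^bsub>A\<^esub> \<oplus>\<^bsub>A\<^esub> (\<i> * of_real (real n + 1) / of_nat m) \<odot>\<^bsub>A\<^esub> x) [^]\<^bsub>A\<^esub> m"
    have y: "y \<in> carrier A" using x by (simp add: y_def)
    have "1/16 \<le> cmod (entry (\<Phi> n y) 1 0)"
      unfolding y_def x_def using ab
      by (intro matrix_representation.cmod_corner_unitary_power_ge[OF rep q2 t m(1)])
        (simp_all add: \<Phi>_t clock_shift_sphere_def r_def)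
    moreover have "cmod (entry (\<Phi> n ((1/2) \<odot>\<^bsub>A\<^esub> y)) 1 0) \<le> C * g n"
      using m(2) y by (intro C) (auto simp: nrm_smult norm_divide y_def)
    ultimately show ?thesis
      using y q2 by (simp add: matrix_representation.entry_rep_scalar[OF rep] norm_mult norm_divide)
  qed
  moreover have "(\<lambda>n. C * g n) \<longlonglongrightarrow> 0"
    using tendsto_mult[OF tendsto_const[of C] \<open>g \<longlonglongrightarrow> 0\<close>] by simp
  then have "\<forall>\<^sub>F n in sequentially. C * g n < 1/32"
    by (rule order_tendstoD) simp
  ultimately show False
    by (metis (mono_tags, lifting) eventually_happens' linorder_not_le sequentially_bot)
qed

theorem theoremC:
  fixes \<theta> :: "real^'n^'n" and A :: "'a cstar" and t :: "'n \<Rightarrow> 'a"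
  assumes "CARD('n) \<ge> 2"
    and "transpose \<theta> = - \<theta>"
    and "\<forall>i j. \<theta> $ i $ j \<in> \<rat>"
    and "universal_sphere_algebra \<theta> A t"
  shows "topologically_fin_gen_over_center A \<and>
    (fin_gen_module (center_ring A) (center_module A) \<longleftrightarrow> (\<forall>i j. \<theta> $ i $ j \<in> \<int>))"
proof (intro conjI iffI)
  interpret unital_cstar_algebra A
    using assms(4) by (simp add: universal_sphere_algebra_def)
  have t: "sphere_relations \<theta> A t"
    using assms(4) by (simp add: universal_sphere_algebra_def)
  then have closed: "t j \<in> carrier A" for j
    by (simp add: sphere_relations_def)
  let ?G = "range t \<union> adj A ` range t"
  have gen: "cstar_generated_by A (range t)" "range t \<subseteq> ?G" "?G \<subseteq> carrier A" "adj A ` ?G \<subseteq> ?G"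
    using assms(4) closed by (auto simp: universal_sphere_algebra_def)
  obtain q :: nat where q: "q > 0" "\<And>i j. of_nat q * \<theta> $ i $ j \<in> \<int>"
    using common_denominator[OF assms(3)] by blast
  show "topologically_fin_gen_over_center A"
    using sphere_phases[OF t q] by (intro topologically_fin_gen_if_phases[OF gen _ q(1)]) auto
  show "fin_gen_module (center_ring A) (center_module A)" if "\<forall>i j. \<theta> $ i $ j \<in> \<int>"
  proof (rule fin_gen_if_commutative[OF gen])
    fix g h assume gh: "g \<in> ?G" "h \<in> ?G"
    then have "g \<in> carrier A" "h \<in> carrier A"
      using gen(3) by blast+
    \<comment> \<open>An integral matrix has the common denominator 1, and a phase with c^1 = 1 is
      trivial.\<close>
    moreover have "\<exists>c. c ^ 1 = 1 \<and> h \<otimes>\<^bsub>A\<^esub> g = c \<odot>\<^bsub>A\<^esub> (g \<otimes>\<^bsub>A\<^esub> h)"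
      using that by (intro sphere_phases[OF t _ _ gh]) auto
    ultimately show "h \<otimes>\<^bsub>A\<^esub> g = g \<otimes>\<^bsub>A\<^esub> h"
      by auto
  qed
next
  show "\<forall>i j. \<theta> $ i $ j \<in> \<int>" if "fin_gen_module (center_ring A) (center_module A)"
    using not_fin_gen_if_not_integral[OF assms(2-4)] that by blast
qed

end
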